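(* Let $p$ and $r$ be primes, and let $n$ be a positive integer that is not a prime power. Then the following two statements are equivalent: (i) for every integer $k$ with $1\le k\le n-1$, the binomial coefficient $\binom{n}{k}$ is divisible by at least one of $p$ or $r$; (ii) for every proper subgroup $H<A_n$, the index $[A_n:H]$ is divisible by at least one of $p$ or $r$.
   Context: $A_n$ denotes the alternating group on $[n]=\{1,\dots,n\}$. *)

theory Defs
  imports "HOL-Algebra.Sym_Groups" "HOL-Algebra.Coset" "HOL-Number_Theory.Prime_Powers"
begin

end

theory Submission
  imports Defs
begin

text \<open>
A \<open>k\<close>-set has a stabilizer of index \<open>n choose k\<close> in \<open>A\<^sub>n\<close>, so (ii) implies (i). Conversely assume (i)
and let \<open>H\<close> be a subgroup of \<open>A\<^sub>n\<close> whose index is divisible by neither \<open>p\<close> nor \<open>r\<close>. If \<open>q\<close> is one of the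
two primes, then every subgroup \<open>K\<close> of \<open>A\<^sub>n\<close> meets some conjugate of \<open>H\<close> in a subgroup of index prime to \<open>q\<close>.
Hence \<open>H\<close> has Jordan sets of every size \<open>q ^ k\<close> with \<open>3 \<le> q ^ k \<le> n\<close>: sets on which the elements of \<open>H\<close>
fixing all other points act transitively.

\<open>H\<close> is transitive by (i). If \<open>H\<close> had \<open>b\<close> blocks of size \<open>a\<close>, then for each of the two primes \<open>q\<close>, either
\<open>a\<close> is a power of \<open>q\<close> or \<open>q\<close> divides none of the coefficients \<open>n choose (j * a)\<close>. With (i) this makes \<open>a\<close> and \<open>b\<close>
powers of the same prime. So \<open>H\<close> is primitive, and Jordan's method makes all sets Jordan that are at
least as large as some Jordan set of prime size. An odd prime \<open>q \<le> n - 3\<close> yields a 3-cycle from a commutator in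
the normalizer of a \<open>q\<close>-cycle. Otherwise the primes are \<open>2\<close> and \<open>n - 1\<close> or \<open>n - 2\<close>; then \<open>H\<close> is 2-transitive
with a Jordan set of size four, and two translates of it yield a 3-cycle since \<open>n = 6\<close> or \<open>n \<ge> 9\<close>.
A Jordan set of size three makes \<open>H\<close> \<open>(n - 2)\<close>-transitive, so \<open>H = A\<^sub>n\<close>.
\<close>

section \<open>Groups of permutations and their indices\<close>

text \<open>Permutations are functions on the whole type, the identity outside \<open>S\<close>, so
  groups on subsets of \<open>S\<close> and groups on \<open>S\<close> are compared by plain
  inclusion.\<close>

definition perm_group :: "'a set \<Rightarrow> ('a \<Rightarrow> 'a) set \<Rightarrow> bool" where
  "perm_group S H \<longleftrightarrow> (\<forall>h\<in>H. h permutes S) \<and> id \<in> H \<and>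
     (\<forall>g\<in>H. \<forall>h\<in>H. g \<circ> h \<in> H) \<and> (\<forall>h\<in>H. inv' h \<in> H)"

lemma perm_groupD:
  assumes "perm_group S H"
  shows "h \<in> H \<Longrightarrow> h permutes S" "id \<in> H" "g \<in> H \<Longrightarrow> h \<in> H \<Longrightarrow> g \<circ> h \<in> H" "h \<in> H \<Longrightarrow> inv' h \<in> H"
  using assms by (auto simp: perm_group_def)

lemma finite_perm_group: "perm_group S H \<Longrightarrow> finite S \<Longrightarrow> finite H"
  by (rule finite_subset[OF _ finite_permutations[of S]]) (auto simp: perm_group_def)

lemma card_perm_group_pos: "perm_group S H \<Longrightarrow> finite S \<Longrightarrow> 0 < card H"
  using finite_perm_group perm_groupD(2) card_gt_0_iff by blast

lemma perm_group_funpow: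
  assumes "perm_group S H" "h \<in> H" shows "h ^^ m \<in> H"
  by (induction m) (simp_all only: funpow.simps perm_groupD(2,3)[OF assms(1)] assms(2))

lemma perm_group_comp_inv:
  assumes "perm_group S H" "h \<in> H"
  shows "inv' h \<circ> h = id" "h \<circ> inv' h = id" "inv' h (h x) = x" "h (inv' h x) = x"
  using assms perm_groupD(1) permutes_inv_o permutes_inverses by metis+

text \<open>The fibres of \<open>h \<mapsto> act h x\<close> are the left cosets of the stabilizer,
  so all have its size. The action is kept abstract because it is applied to points, to point sets
  and to cosets.\<close>

lemma orbit_stabilizer:
  fixes act :: "('a \<Rightarrow> 'a) \<Rightarrow> 'x \<Rightarrow> 'x"
  assumes H: "perm_group S H" and S: "finite S"
    and act_id: "\<And>y. act id y = y"
    and act_comp: "\<And>g h y. act (g \<circ> h) y = act g (act h y)"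
  shows "card ((\<lambda>h. act h x) ` H) * card {h\<in>H. act h x = x} = card H"
proof -
  let ?K = "{h\<in>H. act h x = x}"
  have fin: "finite H" using finite_perm_group[OF H S] .
  have fib: "card {h\<in>H. act h x = y} = card ?K" if "y \<in> (\<lambda>h. act h x) ` H" for y
  proof -
    from that obtain g where g: "g \<in> H" "y = act g x" by blast
    have "{h\<in>H. act h x = y} = (\<lambda>k. g \<circ> k) ` ?K"
    proof (intro equalityI subsetI)
      fix h assume h: "h \<in> {h\<in>H. act h x = y}"
      have "act (inv' g \<circ> h) x = act (inv' g \<circ> g) x" using h g(2) by (simp add: act_comp)
      also have "\<dots> = x" using perm_group_comp_inv(1)[OF H g(1)] act_id by simp
      finally have 1: "inv' g \<circ> h \<in> ?K" using h g(1) H perm_groupD by blast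
      have "h = g \<circ> (inv' g \<circ> h)"
        using perm_group_comp_inv(2)[OF H g(1)] by (metis comp_assoc id_comp)
      then show "h \<in> (\<lambda>k. g \<circ> k) ` ?K" using 1 by (rule image_eqI)
    next
      fix h assume "h \<in> (\<lambda>k. g \<circ> k) ` ?K"
      then show "h \<in> {h\<in>H. act h x = y}" using g H perm_groupD(3) by (auto simp: act_comp)
    qed
    moreover have "inj_on (\<lambda>k. g \<circ> k) ?K"
      by (rule inj_on_inverseI[where g="\<lambda>k. inv' g \<circ> k"])
        (metis perm_group_comp_inv(1)[OF H g(1)] comp_assoc id_comp)
    ultimately show ?thesis by (simp add: card_image)
  qed
  have "card H = (\<Sum>y\<in>(\<lambda>h. act h x) ` H. card {h\<in>H. act h x = y})"
  proof -
    have "H = (\<Union>y\<in>(\<lambda>h. act h x) ` H. {h\<in>H. act h x = y})" by auto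
    then have "card H = card (\<Union>y\<in>(\<lambda>h. act h x) ` H. {h\<in>H. act h x = y})" by simp
    also have "\<dots> = (\<Sum>y\<in>(\<lambda>h. act h x) ` H. card {h\<in>H. act h x = y})"
      by (rule card_UN_disjoint) (use fin in auto)
    finally show ?thesis .
  qed
  then show ?thesis using fib by simp
qed

lemma left_coset_eq_iff:
  assumes G: "perm_group S G" and H: "perm_group S H" and "g \<in> G"
  shows "(\<circ>) g ` H = H \<longleftrightarrow> g \<in> H"
proof
  assume "(\<circ>) g ` H = H"
  then show "g \<in> H" using perm_groupD(2)[OF H] by (metis comp_id image_eqI)
next
  assume g: "g \<in> H"
  have "h \<in> (\<circ>) g ` H" if "h \<in> H" for h
  proof (rule image_eqI)
    show "h = g \<circ> (inv' g \<circ> h)" using perm_group_comp_inv(2)[OF H g] by (metis comp_assoc id_comp)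
    show "inv' g \<circ> h \<in> H" using g that perm_groupD[OF H] by blast
  qed
  then show "(\<circ>) g ` H = H" using g perm_groupD(3)[OF H] by blast
qed

lemma image_comp_comp: "(\<circ>) (g \<circ> h) ` X = (\<circ>) g ` (\<circ>) h ` X"
  by (simp add: image_image comp_assoc)

lemma image_comp_id: "(\<circ>) id ` X = X"
  by simp

lemma card_left_cosets:
  assumes G: "perm_group S G" and H: "perm_group S H" and "H \<subseteq> G" and S: "finite S"
  shows "card ((\<lambda>g. (\<circ>) g ` H) ` G) * card H = card G"
proof -
  have "{g\<in>G. (\<circ>) g ` H = H} = H" using left_coset_eq_iff[OF G H] assms(3) by auto
  then show ?thesis
    using orbit_stabilizer[OF G S, of "\<lambda>g X. (\<circ>) g ` X" H] by (simp add: image_comp_comp)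
qed

lemma perm_group_lagrange:
  assumes "perm_group S G" "perm_group S H" "H \<subseteq> G" "finite S"
  shows "card H dvd card G"
  using card_left_cosets[OF assms] by (metis dvd_triv_right)

lemma perm_group_stabilizer:
  assumes H: "perm_group S H"
    and act_id: "act id x = x"
    and act_comp: "\<And>g h y. act (g \<circ> h) y = act g (act h y)"
  shows "perm_group S {h\<in>H. act h x = x}"
  unfolding perm_group_def
proof (intro conjI ballI)
  fix h assume h: "h \<in> {h\<in>H. act h x = x}"
  then have "act (inv' h) (act h x) = x"
    using perm_group_comp_inv(1)[OF H] act_id act_comp by (metis (mono_tags, lifting) mem_Collect_eq)
  then show "inv' h \<in> {h\<in>H. act h x = x}" using h perm_groupD(4)[OF H] by auto
qed (use perm_groupD[OF H] act_id act_comp in auto)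

text \<open>Some orbit of \<open>K\<close> on the cosets of \<open>H\<close> has length prime to \<open>q\<close>.\<close>

lemma subgroup_meets_conjugate:
  assumes G: "perm_group S G" and H: "perm_group S H" "H \<subseteq> G" and K: "perm_group S K" "K \<subseteq> G"
    and S: "finite S" and q: "\<not> q dvd card G div card H"
  obtains g m where "g \<in> G" "card K = m * card {k\<in>K. inv' g \<circ> k \<circ> g \<in> H}" "\<not> q dvd m"
proof -
  define E where "E = (\<lambda>g. (\<circ>) g ` H) ` G"
  define orb where "orb C = (\<lambda>k. (\<circ>) k ` C) ` K" for C :: "('a \<Rightarrow> 'a) set"
  have finE: "finite E" using finite_perm_group[OF G S] by (simp add: E_def)
  have "card E * card H = card G" unfolding E_def by (rule card_left_cosets[OF G H S])
  then have qE: "\<not> q dvd card E" using q card_perm_group_pos[OF H(1) S]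
    by (metis nonzero_mult_div_cancel_right not_less_zero)
  have self: "C \<in> orb C" for C
    unfolding orb_def using perm_groupD(2)[OF K(1)] by (metis image_eqI image_comp_id)
  have sub: "orb C \<subseteq> E" if "C \<in> E" for C
  proof -
    from that obtain g where g: "g \<in> G" "C = (\<circ>) g ` H" by (auto simp: E_def)
    have "(\<circ>) k ` C \<in> E" if "k \<in> K" for k
      using g that K(2) perm_groupD(3)[OF G, of k g] image_comp_comp[of k g H] unfolding E_def by blast
    then show ?thesis by (auto simp: orb_def)
  qed
  have eq: "orb ((\<circ>) k ` C) = orb C" if k: "k \<in> K" for k C
  proof -
    have "l \<circ> k \<in> K" if "l \<in> K" for l using that k perm_groupD(3)[OF K(1)] by blast
    moreover have "(\<circ>) l ` C = (\<circ>) (l \<circ> inv' k) ` (\<circ>) k ` C" for l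
      using perm_group_comp_inv(1)[OF K(1) k]
      by (metis image_comp_comp comp_assoc comp_id)
    moreover have "l \<circ> inv' k \<in> K" if "l \<in> K" for l using that k perm_groupD[OF K(1)] by blast
    ultimately show ?thesis unfolding orb_def image_comp_comp[symmetric]
      by (smt (verit, ccfv_threshold) image_comp_comp image_iff subsetI subset_antisym)
  qed
  have "\<exists>C\<in>E. \<not> q dvd card (orb C)"
  proof (rule ccontr)
    assume "\<not> ?thesis"
    then have "q dvd card (\<Union>(orb ` E))"
    proof (intro dvd_partition)
      show "finite (\<Union>(orb ` E))" using finite_subset[OF _ finE, of "\<Union>(orb ` E)"] sub by blast
      show "\<forall>c1\<in>orb ` E. \<forall>c2\<in>orb ` E. c1 \<noteq> c2 \<longrightarrow> c1 \<inter> c2 = {}"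
      proof (intro ballI impI, rule ccontr)
        fix c1 c2 assume a: "c1 \<in> orb ` E" "c2 \<in> orb ` E" "c1 \<noteq> c2" "c1 \<inter> c2 \<noteq> {}"
        then obtain C1 C2 D where "c1 = orb C1" "c2 = orb C2" "D \<in> c1" "D \<in> c2" by auto
        then have "orb D = c1" "orb D = c2" using eq by (auto simp: orb_def[of C1] orb_def[of C2])
        then show False using a by simp
      qed
    qed auto
    moreover have "\<Union>(orb ` E) = E" using self sub by blast
    ultimately show False using qE by simp
  qed
  then obtain g where g: "g \<in> G" "\<not> q dvd card (orb ((\<circ>) g ` H))" unfolding E_def by blast
  \<comment> \<open>The stabilizer in \<open>K\<close> of the coset \<open>g H\<close> is the
    intersection of \<open>K\<close> with the conjugate \<open>g H g^-1\<close>.\<close>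
  have stab: "{k\<in>K. (\<circ>) k ` (\<circ>) g ` H = (\<circ>) g ` H} = {k\<in>K. inv' g \<circ> k \<circ> g \<in> H}"
  proof -
    have "(\<circ>) k ` (\<circ>) g ` H = (\<circ>) g ` H \<longleftrightarrow> inv' g \<circ> k \<circ> g \<in> H" if k: "k \<in> K" for k
    proof -
      have inG: "inv' g \<circ> k \<circ> g \<in> G" using k K(2) g(1) by (auto intro!: perm_groupD(3,4)[OF G])
      have "(\<circ>) k ` (\<circ>) g ` H = (\<circ>) g ` (\<circ>) (inv' g \<circ> k \<circ> g) ` H"
        unfolding image_comp_comp[symmetric]
        using perm_group_comp_inv(2)[OF G g(1)] by (simp add: comp_assoc[symmetric])
      moreover have "inj ((\<circ>) g :: ('a \<Rightarrow> 'a) \<Rightarrow> ('a \<Rightarrow> 'a))"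
        by (rule fun.inj_map[OF permutes_inj[OF perm_groupD(1)[OF G g(1)]]])
      ultimately have "(\<circ>) k ` (\<circ>) g ` H = (\<circ>) g ` H \<longleftrightarrow> (\<circ>) (inv' g \<circ> k \<circ> g) ` H = H"
        by (simp add: inj_image_eq_iff)
      then show ?thesis using left_coset_eq_iff[OF G H(1) inG] by simp
    qed
    then show ?thesis by (intro Collect_cong conj_cong refl)
  qed
  have "card K = card (orb ((\<circ>) g ` H)) * card {k\<in>K. inv' g \<circ> k \<circ> g \<in> H}"
    using orbit_stabilizer[OF K(1) S, of "\<lambda>g X. (\<circ>) g ` X" "(\<circ>) g ` H"] stab
    unfolding orb_def by (simp add: image_comp_comp)
  then show ?thesis using that g by blast
qed

text \<open>The index \<open>m\<close> divides the prime \<open>q\<close> and is not divisible by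
  it, so \<open>m = 1\<close>. This takes the place of Sylow's theorem for subgroups of order
  \<open>q\<close>.\<close>

lemma conjugate_into_of_prime_card:
  assumes G: "perm_group S G" and H: "perm_group S H" "H \<subseteq> G" and K: "perm_group S K" "K \<subseteq> G"
    and S: "finite S" and q: "\<not> q dvd card G div card H" "prime q" "card K = q"
  obtains g where "g \<in> G" "\<And>k. k \<in> K \<Longrightarrow> inv' g \<circ> k \<circ> g \<in> H"
proof -
  obtain g m where g: "g \<in> G" "card K = m * card {k\<in>K. inv' g \<circ> k \<circ> g \<in> H}" "\<not> q dvd m"
    using subgroup_meets_conjugate[OF G H K S q(1)] by blast
  have "m dvd q" using g(2) q(3) by simp
  then have "m = 1" using g(3) q(2) by (auto simp: prime_nat_iff)
  then have "{k\<in>K. inv' g \<circ> k \<circ> g \<in> H} = K"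
    using g finite_perm_group[OF K(1) S] by (intro card_subset_eq) auto
  then show ?thesis using that g(1) by blast
qed

section \<open>Jordan sets and primitivity\<close>

definition supported :: "('a \<Rightarrow> 'a) set \<Rightarrow> 'a set \<Rightarrow> ('a \<Rightarrow> 'a) set" where
  "supported H X = {h\<in>H. \<forall>z. z \<notin> X \<longrightarrow> h z = z}"

definition jordan_set :: "('a \<Rightarrow> 'a) set \<Rightarrow> 'a set \<Rightarrow> bool" where
  "jordan_set H X \<longleftrightarrow> (\<forall>x\<in>X. \<forall>y\<in>X. \<exists>h\<in>supported H X. h x = y)"

definition block :: "('a \<Rightarrow> 'a) set \<Rightarrow> 'a set \<Rightarrow> bool" where
  "block H D \<longleftrightarrow> (\<forall>h\<in>H. h ` D = D \<or> h ` D \<inter> D = {})"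

text \<open>Both notions on \<open>X\<close> refer to the elements of \<open>H\<close> that fix every point outside \<open>X\<close>, not to the
setwise stabilizer of \<open>X\<close>.\<close>

definition primitive_on :: "('a \<Rightarrow> 'a) set \<Rightarrow> 'a set \<Rightarrow> bool" where
  "primitive_on H X \<longleftrightarrow> jordan_set H X \<and>
     (\<forall>D. D \<subseteq> X \<and> 1 < card D \<and> card D < card X \<longrightarrow> \<not> block (supported H X) D)"

lemma supported_subset: "supported H X \<subseteq> H"
  by (auto simp: supported_def)

lemma supported_permutes:
  assumes "perm_group S H" "h \<in> supported H X"
  shows "h permutes X"
  using permutes_superset[OF perm_groupD(1)[OF assms(1)]] assms(2) by (auto simp: supported_def)

lemma perm_group_supported:
  assumes "perm_group S H"
  shows "perm_group X (supported H X)" "perm_group S (supported H X)"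
proof -
  have inv: "inv' h \<in> supported H X" if h: "h \<in> supported H X" for h
    using permutes_not_in[OF permutes_inv[OF supported_permutes[OF assms h]]] h perm_groupD(4)[OF assms]
    by (auto simp: supported_def)
  then show "perm_group X (supported H X)"
    using supported_permutes[OF assms] perm_groupD[OF assms] by (auto simp: perm_group_def supported_def)
  show "perm_group S (supported H X)"
    using inv perm_groupD[OF assms] by (auto simp: perm_group_def supported_def)
qed

lemma supported_self: "perm_group S H \<Longrightarrow> supported H S = H"
  using permutes_not_in by (fastforce simp: supported_def perm_group_def)

lemma supported_mono: "X \<subseteq> Y \<Longrightarrow> supported H X \<subseteq> supported H Y"
  by (auto simp: supported_def)

lemma jordan_setE:
  assumes "jordan_set H X" "x \<in> X" "y \<in> X"
  obtains h where "h \<in> supported H X" "h x = y"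
  using assms by (auto simp: jordan_set_def)

lemma jordan_set_image:
  assumes H: "perm_group S H" and g: "g \<in> H" and X: "jordan_set H X"
  shows "jordan_set H (g ` X)"
  unfolding jordan_set_def
proof (intro ballI)
  fix x y assume "x \<in> g ` X" "y \<in> g ` X"
  then obtain x' y' where xy: "x = g x'" "y = g y'" "x' \<in> X" "y' \<in> X" by auto
  obtain h where h: "h \<in> supported H X" "h x' = y'" using jordan_setE[OF X xy(3,4)] .
  have "(g \<circ> h \<circ> inv' g) z = z" if "z \<notin> g ` X" for z
  proof -
    have "inv' g z \<notin> X" using that perm_group_comp_inv(4)[OF H g] by (metis image_eqI)
    then have "h (inv' g z) = inv' g z" using h(1) by (simp add: supported_def)
    then show ?thesis by (simp add: perm_group_comp_inv(4)[OF H g])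
  qed
  moreover have "g \<circ> h \<circ> inv' g \<in> H" using g h(1) supported_subset[of H X]
    by (auto intro!: perm_groupD(3,4)[OF H])
  ultimately have "g \<circ> h \<circ> inv' g \<in> supported H (g ` X)" by (simp add: supported_def)
  moreover have "(g \<circ> h \<circ> inv' g) x = y" using xy h(2) by (simp add: perm_group_comp_inv(3)[OF H g])
  ultimately show "\<exists>h\<in>supported H (g ` X). h x = y" by blast
qed

lemma jordan_set_Un:
  assumes H: "perm_group S H" and X: "jordan_set H X" and Y: "jordan_set H Y" and "X \<inter> Y \<noteq> {}"
  shows "jordan_set H (X \<union> Y)"
proof -
  obtain z where z: "z \<in> X" "z \<in> Y" using assms(4) by blast
  have grp: "perm_group S (supported H (X \<union> Y))" by (rule perm_group_supported(2)[OF H])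
  have sub: "supported H X \<subseteq> supported H (X \<union> Y)" "supported H Y \<subseteq> supported H (X \<union> Y)"
    by (auto intro: supported_mono[THEN subsetD])
  have to: "\<exists>h\<in>supported H (X \<union> Y). h x = z" if "x \<in> X \<union> Y" for x
    using that z sub jordan_setE[OF X, of x z] jordan_setE[OF Y, of x z] by (metis Un_iff subsetD)
  show ?thesis unfolding jordan_set_def
  proof (intro ballI)
    fix x y assume "x \<in> X \<union> Y" "y \<in> X \<union> Y"
    then obtain h g where h: "h \<in> supported H (X \<union> Y)" "h x = z" and g: "g \<in> supported H (X \<union> Y)" "g y = z"
      using to by meson
    have "(inv' g \<circ> h) x = y" using h g perm_group_comp_inv(3)[OF grp g(1), of y] by simp
    moreover have "inv' g \<circ> h \<in> supported H (X \<union> Y)" using h g by (auto intro!: perm_groupD(3,4)[OF grp])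
    ultimately show "\<exists>h\<in>supported H (X \<union> Y). h x = y" by blast
  qed
qed

text \<open>If \<open>g D\<close> and \<open>h D\<close> share a point, then
  \<open>inv' g \<circ> h\<close> moves \<open>D\<close> to a set meeting \<open>D\<close>, hence
  onto \<open>D\<close>, and the translates coincide. So they partition \<open>X\<close> into sets
  of equal size.\<close>

lemma block_translates:
  assumes L: "perm_group X L" and X: "finite X" and trans: "\<forall>x\<in>X. \<forall>y\<in>X. \<exists>h\<in>L. h x = y"
    and D: "D \<subseteq> X" "D \<noteq> {}" "block L D"
  defines "P \<equiv> (\<lambda>h. h ` D) ` L"
  shows "\<Union>P = X" "finite P" "\<And>B. B \<in> P \<Longrightarrow> card B = card D"
    "\<And>B C. B \<in> P \<Longrightarrow> C \<in> P \<Longrightarrow> B \<noteq> C \<Longrightarrow> B \<inter> C = {}"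
    "\<And>h B. h \<in> L \<Longrightarrow> B \<in> P \<Longrightarrow> h ` B \<in> P" "card D * card P = card X"
proof -
  obtain x where x: "x \<in> D" using D(2) by blast
  show un: "\<Union>P = X"
  proof
    show "\<Union>P \<subseteq> X" using D(1) permutes_in_image[OF perm_groupD(1)[OF L]] by (auto simp: P_def)
    show "X \<subseteq> \<Union>P"
    proof
      fix y assume "y \<in> X"
      then obtain h where "h \<in> L" "h x = y" using trans x D(1) by blast
      then show "y \<in> \<Union>P" using x by (auto simp: P_def)
    qed
  qed
  show fin: "finite P" using finite_perm_group[OF L X] by (simp add: P_def)
  show crd: "card B = card D" if "B \<in> P" for B
    using that perm_groupD(1)[OF L] by (auto simp: P_def intro!: card_image permutes_inj_on)
  show dis: "B \<inter> C = {}" if BC: "B \<in> P" "C \<in> P" "B \<noteq> C" for B C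
  proof (rule ccontr)
    assume ne: "B \<inter> C \<noteq> {}"
    from BC obtain g h where gh: "g \<in> L" "h \<in> L" "B = g ` D" "C = h ` D" by (auto simp: P_def)
    from ne gh obtain d e where de: "d \<in> D" "e \<in> D" "g d = h e" by auto
    have k: "inv' g \<circ> h \<in> L" using gh by (auto intro!: perm_groupD(3,4)[OF L])
    have "(inv' g \<circ> h) e = d" using de perm_group_comp_inv(3)[OF L gh(1), of d] by simp
    then have "(inv' g \<circ> h) ` D \<inter> D \<noteq> {}" using de by blast
    then have "(inv' g \<circ> h) ` D = D" using D(3) k unfolding block_def by blast
    then have "g ` (inv' g \<circ> h) ` D = g ` D" by simp
    then have "(g \<circ> inv' g \<circ> h) ` D = g ` D" by (simp add: image_comp comp_assoc)
    then show False using BC(3) gh perm_group_comp_inv(2)[OF L gh(1)] by simp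
  qed
  show "h ` B \<in> P" if hB: "h \<in> L" "B \<in> P" for h B
  proof -
    obtain g where "g \<in> L" "B = g ` D" using hB(2) by (auto simp: P_def)
    then have "h ` B = (h \<circ> g) ` D" "h \<circ> g \<in> L" using hB(1) perm_groupD(3)[OF L] by (auto simp: image_comp)
    then show ?thesis unfolding P_def by (metis image_eqI)
  qed
  show "card D * card P = card X"
    using card_partition[OF fin, of "card D"] un X crd dis by simp
qed

lemma primitive_on_of_prime_card:
  assumes H: "perm_group S H" and X: "jordan_set H X" "prime (card X)"
  shows "primitive_on H X"
  unfolding primitive_on_def
proof (intro conjI allI impI notI X(1))
  fix D assume D: "D \<subseteq> X \<and> 1 < card D \<and> card D < card X" and b: "block (supported H X) D"
  have fin: "finite X" using X(2) by (metis card.infinite not_prime_0)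
  have "card D dvd card X"
    using block_translates(6)[OF perm_group_supported(1)[OF H] fin _ _ _ b] X(1) D
    by (metis card.empty dvd_triv_left jordan_set_def not_less_zero)
  then show False using X(2) D by (auto simp: prime_nat_iff)
qed

text \<open>Choose a translate \<open>g X \<noteq> X\<close> meeting \<open>X\<close> in as many points as possible. If \<open>D = X - g X\<close> had more
than one point, some \<open>h\<close> supported on \<open>X\<close> would move \<open>D\<close> to a set overlapping \<open>D\<close>, and then
\<open>g X\<close> and \<open>h g X\<close> would meet in more points. So \<open>X \<union> g X\<close> is \<open>X\<close> with a single point added.\<close>

lemma primitive_on_insert:
  assumes H: "perm_group S H" and S: "finite S" and prim: "primitive_on H S"
    and X: "primitive_on H X" "X \<subseteq> S" "1 < card X" "card X < card S"
  shows "\<exists>a\<in>S - X. primitive_on H (insert a X)"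
proof -
  have fX: "finite X" using X(2) S finite_subset by blast
  have perm: "g permutes S" if "g \<in> H" for g using that perm_groupD(1)[OF H] by blast
  have cim: "card (g ` A) = card A" if "g \<in> H" for g A
    using permutes_inj_on[OF perm[OF that]] by (rule card_image)
  define A where "A = {g\<in>H. g ` X \<noteq> X \<and> g ` X \<inter> X \<noteq> {}}"
  have "\<not> block H X" using prim X(2-4) by (auto simp: primitive_on_def supported_self[OF H])
  then have "A \<noteq> {}" unfolding block_def A_def by blast
  moreover have "finite A" using finite_perm_group[OF H S] by (simp add: A_def)
  moreover define f where "f h = card (X \<inter> h ` X)" for h
  ultimately have "Max (f ` A) \<in> f ` A" and le: "\<And>h. h \<in> A \<Longrightarrow> f h \<le> Max (f ` A)" by auto
  then obtain g where g: "g \<in> A" "f g = Max (f ` A)" by force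
  then have gmax: "card (X \<inter> h ` X) \<le> card (X \<inter> g ` X)" if "h \<in> A" for h
    using le[OF that] by (simp add: f_def)
  have gH: "g \<in> H" using g by (simp add: A_def)
  define D where "D = X - g ` X"
  have cgX: "card (g ` X) = card X" by (rule cim[OF gH])
  have fgX: "finite (g ` X)" using fX by simp
  have Dne: "card D \<noteq> 0"
  proof
    assume "card D = 0"
    then have "X \<subseteq> g ` X" using fX by (auto simp: D_def)
    then have "X = g ` X" using card_subset_eq[OF fgX] cgX by simp
    then show False using g by (simp add: A_def)
  qed
  have cD: "card D + card (X \<inter> g ` X) = card X"
    using card_Int_Diff[OF fX, of "g ` X"] by (simp add: D_def)
  have int: "card (X \<inter> g ` X) > 0" using g fX by (auto simp: A_def card_gt_0_iff)
  have D1: "card D = 1"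
  proof (rule ccontr)
    assume "card D \<noteq> 1"
    then have "1 < card D" "card D < card X" "D \<subseteq> X" using Dne cD int by (auto simp: D_def)
    then obtain h where h: "h \<in> supported H X" "h ` D \<noteq> D" "h ` D \<inter> D \<noteq> {}"
      using X(1) unfolding primitive_on_def block_def by blast
    have hH: "h \<in> H" and hX: "h ` X = X" and hout: "\<And>z. z \<notin> X \<Longrightarrow> h z = z"
      using h(1) permutes_image[OF supported_permutes[OF H h(1)]] by (auto simp: supported_def)
    have hinj: "inj h" by (rule permutes_inj[OF perm[OF hH]])
    \<comment> \<open>\<open>h\<close> fixes \<open>g X - X\<close> pointwise and permutes
      \<open>X\<close>, so it only replaces the missing part \<open>D\<close> of \<open>X\<close> by
      \<open>h D\<close>.\<close>
    have hg: "h ` g ` X = (g ` X - X) \<union> (X - h ` D)"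
    proof -
      have "g ` X = (g ` X - X) \<union> (X - D)" by (auto simp: D_def)
      then have "h ` g ` X = h ` (g ` X - X) \<union> h ` (X - D)" by (metis image_Un)
      moreover have "h ` (g ` X - X) = g ` X - X" using hout by force
      moreover have "h ` (X - D) = X - h ` D" using image_set_diff[OF hinj] hX by simp
      ultimately show ?thesis by simp
    qed
    have hDX: "h ` D \<subseteq> X" using hX by (auto simp: D_def)
    \<comment> \<open>Applying \<open>inv' g\<close> turns the pair \<open>g X\<close>,
      \<open>h g X\<close> into \<open>X\<close>, \<open>k X\<close>, so their intersection becomes
      comparable with the maximum over translates of \<open>X\<close>.\<close>
    define k where "k = inv' g \<circ> h \<circ> g"
    have kH: "k \<in> H" unfolding k_def using gH hH by (auto intro!: perm_groupD(3,4)[OF H])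
    have gk: "g ` k ` X = h ` g ` X"
      unfolding k_def image_comp comp_assoc[symmetric] using perm_group_comp_inv(2)[OF H gH] by simp
    have neq: "k ` X \<noteq> X"
    proof
      assume "k ` X = X"
      then have e: "h ` g ` X = g ` X" using gk by simp
      have "h ` D = X - h ` g ` X" using hg hDX by blast
      then show False using h(2) e by (simp add: D_def)
    qed
    have eq: "g ` (X \<inter> k ` X) = (g ` X - X) \<union> (X - (D \<union> h ` D))"
    proof -
      have "g ` (X \<inter> k ` X) = g ` X \<inter> h ` g ` X"
        using image_Int[OF permutes_inj[OF perm[OF gH]], of X "k ` X"] gk by simp
      also have "\<dots> = (g ` X - X) \<union> (X - (D \<union> h ` D))" unfolding hg by (auto simp: D_def)
      finally show ?thesis .
    qed
    have c1: "card (g ` X - X) = card D"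
      using card_Int_Diff[OF fgX, of X] cD cgX by (simp add: Int_commute)
    have fD: "finite D" using fX by (simp add: D_def)
    have c2: "card (D \<union> h ` D) < 2 * card D"
    proof -
      have "card (D \<inter> h ` D) > 0" using h(3) fD by (auto simp: card_gt_0_iff)
      then show ?thesis using card_Un_Int[of D "h ` D"] fD cim[OF hH, of D] by simp
    qed
    have c3: "card (X - (D \<union> h ` D)) = card X - card (D \<union> h ` D)"
      by (rule card_Diff_subset) (use fD hDX in \<open>auto simp: D_def\<close>)
    have "card (X \<inter> k ` X) = card D + (card X - card (D \<union> h ` D))"
    proof -
      have "card (X \<inter> k ` X) = card (g ` (X \<inter> k ` X))" using cim[OF gH] by simp
      also have "\<dots> = card (g ` X - X) + card (X - (D \<union> h ` D))"
        unfolding eq by (rule card_Un_disjoint) (use fX in auto)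
      finally show ?thesis using c1 c3 by simp
    qed
    moreover have "card (D \<union> h ` D) \<le> card X"
      by (rule card_mono[OF fX]) (use hDX in \<open>auto simp: D_def\<close>)
    ultimately have "card (X \<inter> k ` X) > card (X \<inter> g ` X)" using c2 cD by linarith
    moreover have "k \<in> A"
    proof -
      have "k ` X \<inter> X \<noteq> {}" using calculation by (metis Int_commute card.empty not_less_zero)
      then show ?thesis using neq kH by (simp add: A_def)
    qed
    ultimately show False using gmax by fastforce
  qed
  have "card (g ` X - X) = 1" using card_Int_Diff[OF fgX, of X] cD cgX D1 by (simp add: Int_commute)
  then obtain a where a: "g ` X - X = {a}" by (auto simp: card_1_singleton_iff)
  have aS: "a \<in> S - X" 
  proof -
    have "a \<in> g ` X" "a \<notin> X" using a by auto
    moreover have "g ` X \<subseteq> S" using X(2) permutes_image[OF perm[OF gH]] by blast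
    ultimately show ?thesis by blast
  qed
  let ?Y = "insert a X"
  have fY: "finite ?Y" using fX by simp
  have Y: "?Y = X \<union> g ` X" using a by auto
  have jX: "jordan_set H X" using X(1) by (simp add: primitive_on_def)
  have jY: "jordan_set H ?Y" unfolding Y
    by (rule jordan_set_Un[OF H jX jordan_set_image[OF H gH jX]]) (use g in \<open>auto simp: A_def\<close>)
  \<comment> \<open>An element on \<open>?Y\<close> sending \<open>a\<close> to \<open>w\<close>
    carries \<open>X\<close> to \<open>?Y - {w}\<close>. Hence the group on \<open>?Y\<close> is
    2-transitive, and a block \<open>D\<close> with points \<open>x \<noteq> y\<close> is broken by
    an element that fixes \<open>x\<close> and sends \<open>y\<close> out of
    \<open>D\<close>.\<close>
  have jw: "jordan_set H (?Y - {w})" if w: "w \<in> ?Y" for w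
  proof -
    obtain k where k: "k \<in> supported H ?Y" "k a = w" using jordan_setE[OF jY _ w] by blast
    have kp: "k permutes ?Y" by (rule supported_permutes[OF H k(1)])
    have "k ` X = k ` (?Y - {a})" using aS by auto
    also have "\<dots> = ?Y - {w}" 
      unfolding image_set_diff[OF permutes_inj[OF kp]] permutes_image[OF kp] using k(2) by simp
    finally show ?thesis using jordan_set_image[OF H _ jX, of k] k(1) supported_subset by fastforce
  qed
  have "\<not> block (supported H ?Y) D" if D: "D \<subseteq> ?Y" "1 < card D" "card D < card ?Y" for D
  proof
    assume b: "block (supported H ?Y) D"
    have "finite D" using D(1) fY finite_subset by blast
    then have "\<not> (\<forall>x\<in>D. \<forall>y\<in>D. x = y)" using D(2) card_le_Suc0_iff_eq[of D] by auto
    then obtain x y where xy: "x \<in> D" "y \<in> D" "x \<noteq> y" by blast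
    have "D \<noteq> ?Y" using D(3) by auto
    then obtain z where z: "z \<in> ?Y" "z \<notin> D" using D(1) by blast
    obtain h where h: "h \<in> supported H (?Y - {x})" "h y = z"
      using jordan_setE[OF jw[of x], of y z] xy z D(1) by blast
    have "h x = x" using h(1) by (simp add: supported_def)
    then have "h ` D \<inter> D \<noteq> {}" "h ` D \<noteq> D" using xy h(2) z by (metis disjoint_iff image_eqI)+
    moreover have "h \<in> supported H ?Y" using h(1) supported_mono[of "?Y - {x}" ?Y H] by blast
    ultimately show False using b by (auto simp: block_def)
  qed
  then show ?thesis using aS jY by (auto simp: primitive_on_def)
qed

lemma jordan_sets_of_all_larger_cards:
  assumes H: "perm_group S H" and S: "finite S" and prim: "primitive_on H S"
    and X: "primitive_on H X" "X \<subseteq> S" "1 < card X"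
  shows "card X \<le> m \<Longrightarrow> m \<le> card S \<Longrightarrow> \<exists>Y\<subseteq>S. card Y = m \<and> jordan_set H Y"
proof -
  have "card X + i \<le> card S \<Longrightarrow> \<exists>Y\<subseteq>S. card Y = card X + i \<and> primitive_on H Y" for i
  proof (induction i)
    case 0 then show ?case using X by auto
  next
    case (Suc i)
    then obtain Y where Y: "Y \<subseteq> S" "card Y = card X + i" "primitive_on H Y" by auto
    obtain a where "a \<in> S - Y" "primitive_on H (insert a Y)"
      using primitive_on_insert[OF H S prim Y(3,1)] Y(2) X(3) Suc.prems by auto
    then show ?case using Y finite_subset[OF Y(1) S] by (intro exI[of _ "insert a Y"]) auto
  qed
  then show "card X \<le> m \<Longrightarrow> m \<le> card S \<Longrightarrow> ?thesis"
    by (metis le_add_diff_inverse primitive_on_def)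
qed

text \<open>Induction from the end of the tuple: once the other points are placed at
  \<open>zs\<close>, the last one is moved by an element supported off \<open>zs\<close>, on a
  complement that still has more than \<open>m\<close> points and so is Jordan.\<close>

lemma tuple_transitive:
  assumes H: "perm_group S H" and S: "finite S"
    and J: "\<And>Y. Y \<subseteq> S \<Longrightarrow> m < card Y \<Longrightarrow> jordan_set H Y"
  shows "distinct xs \<Longrightarrow> distinct ys \<Longrightarrow> length xs = length ys \<Longrightarrow> set xs \<subseteq> S \<Longrightarrow> set ys \<subseteq> S \<Longrightarrow>
    length xs + m \<le> card S \<Longrightarrow> \<exists>h\<in>H. map h xs = ys"
proof (induction xs arbitrary: ys rule: rev_induct)
  case Nil then show ?case using perm_groupD(2)[OF H] by auto
next
  case (snoc x xs)
  obtain zs y where ys: "ys = zs @ [y]" using snoc.prems(3) by (cases ys rule: rev_cases) auto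
  obtain h where h: "h \<in> H" "map h xs = zs" using snoc ys by auto
  let ?Y = "S - set zs"
  have "card ?Y = card S - length zs"
    using snoc.prems(2,5) ys S by (simp add: card_Diff_subset distinct_card)
  then have J': "jordan_set H ?Y" using snoc.prems(3,6) ys by (intro J) auto
  have "h x \<in> S" using snoc.prems(4) permutes_in_image[OF perm_groupD(1)[OF H h(1)]] by simp
  moreover have "h x \<notin> set zs"
  proof
    assume "h x \<in> set zs"
    then obtain x' where "x' \<in> set xs" "h x = h x'" using h(2) by auto
    then show False using permutes_inj[OF perm_groupD(1)[OF H h(1)]] snoc.prems(1) by (auto dest: injD)
  qed
  ultimately obtain k where k: "k \<in> supported H ?Y" "k (h x) = y"
    using jordan_setE[OF J', of "h x" y] snoc.prems(2,5) ys by auto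
  have "map (k \<circ> h) (xs @ [x]) = ys"
  proof -
    have "map k zs = zs" using k(1) by (intro map_idI) (auto simp: supported_def)
    then have "map k (map h xs) = zs" using h(2) by simp
    then show ?thesis using k(2) ys by simp
  qed
  moreover have "k \<circ> h \<in> H" using k(1) h(1) supported_subset[of H ?Y] perm_groupD(3)[OF H] by blast
  ultimately show ?case by blast
qed

text \<open>Induction downwards on size. One Jordan set \<open>Z\<close> of the size of
  \<open>Y\<close> is known; as all larger sets are Jordan, \<open>H\<close> is transitive on tuples
  of \<open>card S - card Y\<close> points and so carries the complement of \<open>Z\<close> to that
  of \<open>Y\<close>.\<close>

lemma all_large_sets_jordan:
  assumes H: "perm_group S H" and S: "finite S" and prim: "primitive_on H S"
    and X: "primitive_on H X" "X \<subseteq> S" "1 < card X"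
    and Y: "Y \<subseteq> S" "card X \<le> card Y"
  shows "jordan_set H Y"
proof -
  have "\<forall>Y\<subseteq>S. card X \<le> card Y \<and> card S - card Y = i \<longrightarrow> jordan_set H Y" for i
  proof (induction i rule: less_induct)
    case (less i)
    show ?case
    proof (intro allI impI)
      fix Y assume Y: "Y \<subseteq> S" "card X \<le> card Y \<and> card S - card Y = i"
      have J: "jordan_set H Z" if Z: "Z \<subseteq> S" "card Y < card Z" for Z
      proof -
        have "card S - card Z < i" using Y Z card_mono[OF S Z(1)] by linarith
        then show ?thesis using less[of "card S - card Z"] Z Y by auto
      qed
      have cY: "card Y \<le> card S" by (rule card_mono[OF S Y(1)])
      obtain Z where Z: "Z \<subseteq> S" "card Z = card Y" "jordan_set H Z"
        using jordan_sets_of_all_larger_cards[OF H S prim X, of "card Y"] Y cY by auto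
      obtain xs where xs: "set xs = S - Z" "distinct xs" using finite_distinct_list[of "S - Z"] S by auto
      obtain ys where ys: "set ys = S - Y" "distinct ys" using finite_distinct_list[of "S - Y"] S by auto
      have lx: "length xs = card S - card Y"
        using distinct_card[OF xs(2)] xs(1) Z card_Diff_subset[OF finite_subset[OF Z(1) S] Z(1)] by simp
      have ly: "length ys = card S - card Y"
        using distinct_card[OF ys(2)] ys(1) card_Diff_subset[OF finite_subset[OF Y(1) S] Y(1)] by simp
      obtain h where h: "h \<in> H" "map h xs = ys"
        using tuple_transitive[where m="card Y", OF H S J xs(2) ys(2)] lx ly xs(1) ys(1) cY by auto
      have p: "h permutes S" by (rule perm_groupD(1)[OF H h(1)])
      have "h ` (S - Z) = S - Y" using h(2) xs(1) ys(1) by (metis image_set)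
      then have "S - h ` Z = S - Y" using image_set_diff[OF permutes_inj[OF p], of S Z] permutes_image[OF p] by simp
      moreover have "h ` Z \<subseteq> S" using Z(1) permutes_image[OF p] by blast
      ultimately have "h ` Z = Y" using Y(1) by blast
      then show "jordan_set H Y" using jordan_set_image[OF H h(1) Z(3)] by simp
    qed
  qed
  then show ?thesis using Y by blast
qed

section \<open>Alternating groups\<close>

definition alternating :: "'a set \<Rightarrow> ('a \<Rightarrow> 'a) set" where
  "alternating S = {h. h permutes S \<and> evenperm h}"

lemma perm_group_alternating: "finite S \<Longrightarrow> perm_group S (alternating S)"
  unfolding perm_group_def alternating_def
  using permutes_imp_permutation[of S] by (auto simp: permutes_compose permutes_inv evenperm_comp evenperm_inv)

lemma alternating_mono: "X \<subseteq> S \<Longrightarrow> alternating X \<subseteq> alternating S"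
  by (auto simp: alternating_def intro: permutes_subset)

lemma transpose_comp_in_alternating:
  assumes "{a, b, c, d} \<subseteq> S" "a \<noteq> b" "c \<noteq> d"
  shows "transpose a b \<circ> transpose c d \<in> alternating S"
  using assms by (auto simp: alternating_def evenperm_comp evenperm_swap permutation_swap_id
      intro!: permutes_compose permutes_swap_id)

lemma alternating_transitive:
  assumes "finite S" "3 \<le> card S" "x \<in> S" "y \<in> S"
  shows "\<exists>h\<in>alternating S. h x = y"
proof (cases "x = y")
  case True
  then show ?thesis using perm_groupD(2)[OF perm_group_alternating[OF assms(1)]] by (intro bexI[of _ id]) auto
next
  case False
  have "card (S - {x, y}) \<noteq> 0" using assms False by (simp add: card_Diff_subset)
  then obtain z where z: "z \<in> S" "z \<noteq> x" "z \<noteq> y" by (metis DiffE card.empty equals0I insert_iff)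
  have "transpose x y \<circ> transpose y z \<in> alternating S"
    by (rule transpose_comp_in_alternating) (use z assms False in auto)
  moreover have "(transpose x y \<circ> transpose y z) x = y" using z False by simp
  ultimately show ?thesis by blast
qed

text \<open>The only candidate besides the identity is a transposition, which is odd.\<close>

lemma alternating_fixes_all_but_two:
  assumes "h \<in> alternating S" "\<And>z. z \<noteq> a \<Longrightarrow> z \<noteq> b \<Longrightarrow> h z = z"
  shows "h = id"
proof -
  have "h permutes {a, b}" using permutes_superset[of h S "{a, b}"] assms by (auto simp: alternating_def)
  then have "h = id \<or> h = transpose a b" by (simp add: permutes_doubleton_iff)
  then show ?thesis using assms(1) by (auto simp: alternating_def evenperm_swap)
qed

text \<open>An alternating group on \<open>q ^ k\<close> points meets a conjugate of \<open>H\<close> in a subgroup of index prime to \<open>q\<close>,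
and such a subgroup is still transitive because \<open>q ^ k\<close> divides its orbit lengths.\<close>

lemma jordan_set_of_prime_power_card:
  assumes S: "finite S" and H: "perm_group S H" "H \<subseteq> alternating S"
    and q: "prime q" "\<not> q dvd card (alternating S) div card H" and k: "3 \<le> q ^ k" "q ^ k \<le> card S"
  shows "\<exists>X\<subseteq>S. card X = q ^ k \<and> jordan_set H X"
proof -
  obtain Y where Y: "Y \<subseteq> S" "card Y = q ^ k" "finite Y"
    using obtain_subset_with_card_n[OF k(2)] by metis
  let ?G = "alternating S" and ?K = "alternating Y"
  have G: "perm_group S ?G" by (rule perm_group_alternating[OF S])
  have KY: "perm_group Y ?K" by (rule perm_group_alternating[OF Y(3)])
  have K: "perm_group S ?K" using KY Y(1) by (auto simp: perm_group_def intro: permutes_subset)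
  obtain g m where g: "g \<in> ?G" "card ?K = m * card {k\<in>?K. inv' g \<circ> k \<circ> g \<in> H}" "\<not> q dvd m"
    using subgroup_meets_conjugate[OF G H K alternating_mono[OF Y(1)] S q(2)] by blast
  define L where "L = {k\<in>?K. inv' g \<circ> k \<circ> g \<in> H}"
  have L: "perm_group Y L" unfolding perm_group_def
  proof (intro conjI ballI)
    show "id \<in> L" using perm_groupD(2)[OF KY] perm_groupD(2)[OF H(1)] perm_group_comp_inv(1)[OF G g(1)]
      by (simp add: L_def)
    fix h assume h: "h \<in> L"
    show "h permutes Y" using h perm_groupD(1)[OF KY] by (simp add: L_def)
    have bg: "bij g" "bij h" using g(1) h by (auto simp: alternating_def L_def intro: permutes_bij)
    have "inv' (inv' g \<circ> h \<circ> g) = inv' g \<circ> inv' h \<circ> g"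
      using bg by (simp add: o_inv_distrib bij_comp bij_imp_bij_inv inv_inv_eq comp_assoc)
    then show "inv' h \<in> L" using h perm_groupD(4)[OF KY] perm_groupD(4)[OF H(1), of "inv' g \<circ> h \<circ> g"]
      by (simp add: L_def)
    fix h' assume h': "h' \<in> L"
    have "(inv' g \<circ> h \<circ> g) \<circ> (inv' g \<circ> h' \<circ> g) = inv' g \<circ> (h \<circ> h') \<circ> g"
      using perm_group_comp_inv(4)[OF G g(1)] by (simp add: fun_eq_iff)
    then show "h \<circ> h' \<in> L"
      using h h' perm_groupD(3)[OF KY] perm_groupD(3)[OF H(1), of "inv' g \<circ> h \<circ> g" "inv' g \<circ> h' \<circ> g"]
      by (simp add: L_def)
  qed
  have LK: "L \<subseteq> ?K" by (auto simp: L_def)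
  have trans: "(\<lambda>h. h x) ` L = Y" if x: "x \<in> Y" for x
  proof -
    \<comment> \<open>This uses \<open>3 \<le> q ^ k\<close>: the alternating group on two points is
      not transitive.\<close>
    have oK: "(\<lambda>h. h x) ` ?K = Y"
      using alternating_transitive[OF Y(3) _ x] k(1) Y(2) permutes_in_image[OF perm_groupD(1)[OF KY]] x by fastforce
    let ?Kx = "{h\<in>?K. h x = x}" and ?Lx = "{h\<in>L. h x = x}"
    have 1: "card Y * card ?Kx = card ?K"
      using orbit_stabilizer[OF KY Y(3), of "\<lambda>h. h" x] oK by simp
    have 2: "card ((\<lambda>h. h x) ` L) * card ?Lx = card L"
      using orbit_stabilizer[OF L Y(3), of "\<lambda>h. h" x] by simp
    have pK: "perm_group Y ?Kx" by (rule perm_group_stabilizer[OF KY]) auto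
    have pL: "perm_group Y ?Lx" by (rule perm_group_stabilizer[OF L]) auto
    obtain c where c: "card ?Kx = card ?Lx * c"
      using perm_group_lagrange[OF pK pL _ Y(3)] LK by (auto elim: dvdE)
    \<comment> \<open>Orbit-stabilizer for both groups gives \<open>q ^ k * c = m * l\<close>, where
      \<open>l\<close> is the orbit length of \<open>L\<close>. As \<open>m\<close> is prime to
      \<open>q\<close>, the power \<open>q ^ k\<close> divides \<open>l \<le> q ^ k\<close>.\<close>
    have "card ?Lx * (q ^ k * c) = card ?Lx * (m * card ((\<lambda>h. h x) ` L))"
    proof -
      have "card ?Lx * (q ^ k * c) = card Y * card ?Kx" using c Y(2) by simp
      also have "\<dots> = m * card L" using 1 g(2) unfolding L_def by simp
      also have "\<dots> = card ?Lx * (m * card ((\<lambda>h. h x) ` L))" using 2[symmetric] by simp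
      finally show ?thesis .
    qed
    then have "q ^ k * c = m * card ((\<lambda>h. h x) ` L)" using card_perm_group_pos[OF pL Y(3)] by simp
    then have "q ^ k dvd m * card ((\<lambda>h. h x) ` L)" by (metis dvd_triv_left)
    moreover have "coprime (q ^ k) m" using g(3) q(1) by (simp add: prime_imp_coprime)
    ultimately have "q ^ k dvd card ((\<lambda>h. h x) ` L)" by (simp add: coprime_dvd_mult_right_iff)
    moreover have sub: "(\<lambda>h. h x) ` L \<subseteq> Y" using LK oK by blast
    moreover have "card ((\<lambda>h. h x) ` L) > 0"
      using perm_groupD(2)[OF L] finite_perm_group[OF L Y(3)] by (auto simp: card_gt_0_iff)
    ultimately have "card Y \<le> card ((\<lambda>h. h x) ` L)" using Y(2) by (simp add: dvd_imp_le)
    then show ?thesis using card_seteq[OF Y(3) sub] by simp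
  qed
  have gp: "inv' g permutes S" using perm_groupD(1)[OF G perm_groupD(4)[OF G g(1)]] .
  have "jordan_set H (inv' g ` Y)"
    unfolding jordan_set_def
  proof (intro ballI)
    fix x y assume "x \<in> inv' g ` Y" "y \<in> inv' g ` Y"
    then obtain x' y' where xy: "x' \<in> Y" "x = inv' g x'" "y' \<in> Y" "y = inv' g y'" by auto
    then obtain h where h: "h \<in> L" "h x' = y'" using trans[OF xy(1)] by auto
    let ?h = "inv' g \<circ> h \<circ> g"
    have "?h z = z" if "z \<notin> inv' g ` Y" for z
    proof -
      have "g z \<notin> Y" using that perm_group_comp_inv(3)[OF G g(1)] by (metis image_eqI)
      then have "h (g z) = g z" using permutes_not_in[OF perm_groupD(1)[OF L h(1)]] by simp
      then show ?thesis by (simp add: perm_group_comp_inv(3)[OF G g(1)])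
    qed
    moreover have "?h \<in> H" using h(1) by (simp add: L_def)
    ultimately have "?h \<in> supported H (inv' g ` Y)" by (simp add: supported_def)
    moreover have "?h x = y" using xy h(2) by (simp add: perm_group_comp_inv(4)[OF G g(1)])
    ultimately show "\<exists>h\<in>supported H (inv' g ` Y). h x = y" by blast
  qed
  moreover have "inv' g ` Y \<subseteq> S" using Y(1) permutes_image[OF gp] by blast
  moreover have "card (inv' g ` Y) = q ^ k" using Y(2) card_image[OF permutes_inj_on[OF gp]] by metis
  ultimately show ?thesis by blast
qed

section \<open>Set stabilizers in alternating groups, and recognition by a 3-cycle\<close>

lemma alternating_moves_subset:
  assumes S: "finite S" "3 \<le> card S" and A: "A \<subseteq> S" and B: "B \<subseteq> S" "card A = card B"
  shows "\<exists>h\<in>alternating S. h ` A = B"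
proof -
  have fin: "finite A" "finite B" "finite (S - A)" "finite (S - B)" using S A B finite_subset by auto
  obtain f where f: "bij_betw f A B" using finite_same_card_bij[OF fin(1,2) B(2)] by blast
  have "card (S - A) = card (S - B)" using fin A B by (simp add: card_Diff_subset)
  then obtain f' where f': "bij_betw f' (S - A) (S - B)" using finite_same_card_bij[OF fin(3,4)] by blast
  define h where "h x = (if x \<in> A then f x else if x \<in> S then f' x else x)" for x
  have bA: "bij_betw h A B" using f by (simp add: h_def cong: bij_betw_cong)
  have bB: "bij_betw h (S - A) (S - B)" using f' by (subst bij_betw_cong[where g=f']) (auto simp: h_def)
  have "bij_betw h (A \<union> (S - A)) (B \<union> (S - B))" by (rule bij_betw_combine[OF bA bB]) auto
  then have "bij_betw h S S" using A B by (simp add: Un_absorb1)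
  then have hp: "h permutes S" by (rule bij_imp_permutes) (use A in \<open>auto simp: h_def\<close>)
  have hA: "h ` A = B" using bA by (simp add: bij_betw_def)
  show ?thesis
  proof (cases "evenperm h")
    case True then show ?thesis using hp hA by (auto simp: alternating_def)
  next
    case False
    \<comment> \<open>An odd bijection is corrected by a transposition inside \<open>B\<close> or
      its complement; one of them has two points.\<close>
    have "2 \<le> card B \<or> 2 \<le> card (S - B)" using S(2) card_Diff_subset[OF fin(2) B(1)] by linarith
    then obtain C where C: "C \<subseteq> S" "2 \<le> card C" "C = B \<or> C = S - B" using B(1) by blast
    have "finite C" using C(1) S(1) finite_subset by blast
    then have "\<not> (\<forall>x\<in>C. \<forall>y\<in>C. x = y)" using C(2) card_le_Suc0_iff_eq[of C] by auto
    then obtain a b where ab: "a \<in> C" "b \<in> C" "a \<noteq> b" by blast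
    let ?t = "transpose a b"
    have "?t ` B = B" using ab C(3) B(1)
      by (auto simp: transpose_def image_iff split: if_splits)
    then have "(?t \<circ> h) ` A = B" using hA by (metis image_comp)
    moreover have "?t \<circ> h permutes S" using hp ab C(1) by (auto intro!: permutes_compose permutes_swap_id)
    moreover have "evenperm (?t \<circ> h)"
      using False ab(3) permutes_imp_permutation[OF S(1) hp] by (simp add: evenperm_comp evenperm_swap permutation_swap_id)
    ultimately show ?thesis by (auto simp: alternating_def)
  qed
qed

text \<open>The subsets of a fixed size form a single orbit; this is how binomial coefficients
  become indices.\<close>

lemma card_set_stabilizer_alternating:
  assumes S: "finite S" "3 \<le> card S" and A: "A \<subseteq> S"
  shows "(card S choose card A) * card {h\<in>alternating S. h ` A = A} = card (alternating S)"
proof -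
  have G: "perm_group S (alternating S)" by (rule perm_group_alternating[OF S(1)])
  have "(\<lambda>h. h ` A) ` alternating S = {B. B \<subseteq> S \<and> card B = card A}"
  proof (intro equalityI subsetI)
    fix B assume "B \<in> (\<lambda>h. h ` A) ` alternating S"
    then obtain h where h: "h \<in> alternating S" "B = h ` A" by blast
    have "h permutes S" by (rule perm_groupD(1)[OF G h(1)])
    then show "B \<in> {B. B \<subseteq> S \<and> card B = card A}"
      using h(2) A by (metis (mono_tags, lifting) card_image image_mono mem_Collect_eq permutes_image permutes_inj_on)
  next
    fix B assume "B \<in> {B. B \<subseteq> S \<and> card B = card A}"
    then have "\<exists>h\<in>alternating S. h ` A = B" using alternating_moves_subset[OF S A] by simp
    then show "B \<in> (\<lambda>h. h ` A) ` alternating S" by blast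
  qed
  then show ?thesis
    using orbit_stabilizer[OF G S(1), of "(`)" A] n_subsets[OF S(1), of "card A"] by (simp add: image_comp)
qed

text \<open>A nontrivial even permutation moves at least three points, so \<open>h\<close> moves
  \<open>a\<close>, \<open>b\<close>, \<open>c\<close> and is a 3-cycle; its powers are transitive
  on them.\<close>

lemma jordan_set_of_three_point_element:
  assumes H: "perm_group S H" "H \<subseteq> alternating S" and h: "h \<in> H" "h \<noteq> id"
    and fxd: "\<And>z. z \<noteq> a \<Longrightarrow> z \<noteq> b \<Longrightarrow> z \<noteq> c \<Longrightarrow> h z = z"
  shows "jordan_set H {a, b, c}" "card {a, b, c} = 3"
proof -
  have inj: "inj h" using permutes_inj[OF perm_groupD(1)[OF H(1) h(1)]] .
  have hA: "h \<in> alternating S" using H(2) h(1) by blast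
  have nofix: "h a \<noteq> a" "h b \<noteq> b" "h c \<noteq> c"
    using alternating_fixes_all_but_two[OF hA] fxd h(2) by metis+
  have d: "a \<noteq> b" "b \<noteq> c" "a \<noteq> c"
    using alternating_fixes_all_but_two[OF hA] fxd h(2) by metis+
  have "h x \<in> {a, b, c}" if "x \<in> {a, b, c}" for x
  proof (rule ccontr)
    assume n: "h x \<notin> {a, b, c}"
    then have "h (h x) = h x" using fxd by auto
    then have "h x = x" using inj by (auto dest: injD)
    then show False using n that by simp
  qed
  then have "h a = b \<or> h a = c" "h b = a \<or> h b = c" "h c = a \<or> h c = b" using nofix by blast+
  moreover have "h a \<noteq> h b" "h b \<noteq> h c" "h a \<noteq> h c" using d inj by (auto simp: inj_eq)
  ultimately have cyc: "h a = b \<and> h b = c \<and> h c = a \<or> h a = c \<and> h c = b \<and> h b = a" by metis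
  from d show "card {a, b, c} = 3" by simp
  have "{id, h, h \<circ> h} \<subseteq> supported H {a, b, c}"
    using fxd h(1) perm_groupD(2,3)[OF H(1)] by (auto simp: supported_def)
  moreover have "\<exists>k\<in>{id, h, h \<circ> h}. k x = y" if "x \<in> {a, b, c}" "y \<in> {a, b, c}" for x y
    using that cyc by auto
  ultimately show "jordan_set H {a, b, c}" unfolding jordan_set_def by (meson subsetD)
qed

text \<open>All sets of at least three points become Jordan, so \<open>H\<close> is transitive on
  tuples of \<open>card S - 2\<close> points. An \<open>h\<close> in \<open>H\<close> agreeing with
  \<open>s\<close> off two points differs from \<open>s\<close> by an even permutation of these two,
  which is the identity.\<close>

lemma alternating_subset_of_jordan_three:
  assumes S: "finite S" and H: "perm_group S H" and prim: "primitive_on H S"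
    and X: "jordan_set H X" "X \<subseteq> S" "card X = 3" and H': "H \<subseteq> alternating S"
  shows "alternating S \<subseteq> H"
proof
  fix s assume s: "s \<in> alternating S"
  have G: "perm_group S (alternating S)" by (rule perm_group_alternating[OF S])
  have sp: "s permutes S" by (rule perm_groupD(1)[OF G s])
  have J: "jordan_set H Y" if "Y \<subseteq> S" "2 < card Y" for Y
    using all_large_sets_jordan[OF H S prim primitive_on_of_prime_card[OF H X(1)] X(2) _ that(1)] that X(3) by simp
  obtain xs where xs: "set xs = S" "distinct xs" using finite_distinct_list[OF S] by blast
  have len: "length xs = card S" using distinct_card[OF xs(2)] xs(1) by simp
  have c3: "3 \<le> card S" using card_mono[OF S X(2)] X(3) by simp
  then obtain a b ys where ys: "xs = a # b # ys" using len by (cases xs; cases "tl xs") auto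
  have "\<exists>h\<in>H. map h ys = map s ys"
  proof (rule tuple_transitive[OF H S J])
    show "distinct (map s ys)" using xs(2) ys permutes_inj_on[OF sp] by (simp add: distinct_map)
    show "set (map s ys) \<subseteq> S" using xs(1) ys permutes_in_image[OF sp] by auto
  qed (use xs ys len in auto)
  then obtain h where h: "h \<in> H" "\<And>y. y \<in> set ys \<Longrightarrow> h y = s y" by (auto simp: map_eq_conv)
  have hG: "h \<in> alternating S" using h(1) H' by blast
  have "(inv' h \<circ> s) z = z" if "z \<noteq> a" "z \<noteq> b" for z
  proof (cases "z \<in> S")
    case True
    then have "h z = s z" using that xs(1) ys h(2) by auto
    then show ?thesis using perm_group_comp_inv(3)[OF H h(1), of z] by simp
  next
    case False
    then show ?thesis using permutes_not_in[OF sp] permutes_not_in[OF perm_groupD(1)[OF H perm_groupD(4)[OF H h(1)]]] by simp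
  qed
  moreover have "inv' h \<circ> s \<in> alternating S" using hG s by (auto intro!: perm_groupD(3,4)[OF G])
  ultimately have "inv' h \<circ> s = id" using alternating_fixes_all_but_two[of "inv' h \<circ> s"] by blast
  then have "s = h" using perm_group_comp_inv(2)[OF H h(1)] by (metis comp_assoc comp_id id_comp)
  then show "s \<in> H" using h(1) by simp
qed

section \<open>Binomial coefficients and imprimitive groups\<close>

lemma fact_add_eq_prod: "fact (a + k) = fact a * (\<Prod>i=1..k. a + i)" for a k :: nat
  by (induction k) (auto simp: prod.nat_ivl_Suc' algebra_simps)

text \<open>The multiples of \<open>p\<close> up to \<open>p * m\<close> contribute
  \<open>p ^ m * fact m\<close>; the other factors, in runs of \<open>p - 1\<close>, are prime to
  \<open>p\<close>.\<close>

lemma fact_mult_prime: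
  assumes p: "prime (p :: nat)"
  shows "\<exists>u. fact (p * m) = p ^ m * fact m * u \<and> \<not> p dvd u"
proof (induction m)
  case 0 show ?case using p by (intro exI[of _ 1]) (auto simp: prime_nat_iff)
next
  case (Suc m)
  then obtain u where u: "fact (p * m) = p ^ m * fact m * u" "\<not> p dvd u" by blast
  define w where "w = (\<Prod>i=1..p-1. p * m + i)"
  have p0: "p > 0" using p by (simp add: prime_gt_0_nat)
  have "\<not> p dvd w"
  proof
    assume "p dvd w"
    then obtain i where i: "i \<in> {1..p-1}" "p dvd p * m + i" using p by (auto simp: w_def prime_dvd_prod_iff)
    then have "p dvd i" by (simp add: dvd_add_right_iff)
    then have "p \<le> i" using i(1) by (intro dvd_imp_le) auto
    then show False using i(1) p0 by simp
  qed
  then have "\<not> p dvd u * w" using u(2) p by (simp add: prime_dvd_mult_iff)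
  moreover have "fact (p * Suc m) = p ^ Suc m * fact (Suc m) * (u * w)"
  proof -
    have "p * Suc m = Suc (p * m + (p - 1))" using p0 by simp
    then have "fact (p * Suc m) = p * Suc m * fact (p * m + (p - 1))" by (metis fact_Suc of_nat_id)
    also have "\<dots> = p * Suc m * (p ^ m * fact m * u * w)" unfolding fact_add_eq_prod w_def u(1) by simp
    finally show ?thesis by (simp add: algebra_simps)
  qed
  ultimately show ?case by blast
qed

text \<open>Inserting the factorizations of the three factorials shows that the two coefficients
  agree up to factors prime to \<open>p\<close>, a weak form of Lucas' congruence.\<close>

lemma prime_dvd_binomial_mult:
  assumes p: "prime (p :: nat)" and j: "j \<le> b" and d: "p dvd (p * b choose (p * j))"
  shows "p dvd (b choose j)"
proof -
  obtain u where u: "fact (p * b) = p ^ b * fact b * u" "\<not> p dvd u" using fact_mult_prime[OF p] by blast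
  obtain v where v: "fact (p * j) = p ^ j * fact j * v" "\<not> p dvd v" using fact_mult_prime[OF p] by blast
  obtain w where w: "fact (p * (b - j)) = p ^ (b - j) * fact (b - j) * w" "\<not> p dvd w"
    using fact_mult_prime[OF p] by blast
  have "fact (p * j) * fact (p * b - p * j) * (p * b choose (p * j)) = fact (p * b)"
    by (rule binomial_fact_lemma) (use j in simp)
  then have "(p ^ j * fact j * v) * (p ^ (b - j) * fact (b - j) * w) * (p * b choose (p * j)) = p ^ b * fact b * u"
    using u(1) v(1) w(1) by (simp add: right_diff_distrib')
  moreover have "p ^ b = p ^ j * p ^ (b - j)" using j by (simp flip: power_add)
  moreover have "fact b = fact j * fact (b - j) * (b choose j)" using binomial_fact_lemma[OF j] by simp
  ultimately have "(p ^ j * p ^ (b - j) * fact j * fact (b - j)) * (v * w * (p * b choose (p * j)))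
      = (p ^ j * p ^ (b - j) * fact j * fact (b - j)) * ((b choose j) * u)"
    by (simp only: mult_ac)
  then have "v * w * (p * b choose (p * j)) = (b choose j) * u"
    using p by (simp add: prime_gt_0_nat)
  then have "p dvd (b choose j) * u" using d by (metis dvd_mult)
  then show ?thesis using p u(2) by (simp add: prime_dvd_mult_iff)
qed

lemma prime_dvd_binomial_mult_power:
  assumes p: "prime (p :: nat)" and j: "j \<le> b"
  shows "p dvd (p ^ i * b choose (p ^ i * j)) \<Longrightarrow> p dvd (b choose j)"
proof (induction i)
  case (Suc i)
  then show ?case using prime_dvd_binomial_mult[OF p, of "p ^ i * j" "p ^ i * b"] j by (simp add: mult.assoc)
qed simp

text \<open>For \<open>b = p ^ s * m\<close> with \<open>p\<close> not dividing
  \<open>m > 1\<close>, the coefficient at \<open>p ^ s\<close> would pass its divisibility by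
  \<open>p\<close> down to \<open>m choose 1 = m\<close>.\<close>

lemma prime_power_if_dvd_binomials:
  assumes p: "prime (p :: nat)" and b: "0 < b" and d: "\<And>j. 0 < j \<Longrightarrow> j < b \<Longrightarrow> p dvd (b choose j)"
  shows "\<exists>s. b = p ^ s"
proof -
  obtain s m where m: "b = p ^ s * m" "\<not> p dvd m"
    using multiplicity_decompose'[of b p] b p by (metis not_prime_unit gr_implies_not0)
  have "m = 1"
  proof (rule ccontr)
    assume "m \<noteq> 1"
    then have m1: "1 < m" using b m(1) by (cases m) auto
    have "p dvd (p ^ s * m choose (p ^ s * 1))"
      using d[of "p ^ s"] m(1) m1 p by (simp add: prime_gt_0_nat)
    then have "p dvd (m choose 1)" by (rule prime_dvd_binomial_mult_power[OF p, rotated]) (use m1 in simp)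
    then show False using m(2) by simp
  qed
  then show ?thesis using m(1) by auto
qed

text \<open>Each further block costs a factor equal to the length of an orbit on \<open>P\<close>,
  which is at most \<open>card P < q\<close> and so not divisible by \<open>q\<close>.\<close>

lemma index_coprime_stabilizer_of_blocks:
  assumes S: "finite S" and H: "perm_group S H" and P: "finite P" "card P < q" and q: "prime q"
    and act: "\<And>h B. h \<in> H \<Longrightarrow> B \<in> P \<Longrightarrow> h ` B \<in> P"
    and T: "finite T" "T \<subseteq> P"
  shows "perm_group S {h\<in>H. \<forall>B\<in>T. h ` B = B} \<and> (\<exists>m. card H = m * card {h\<in>H. \<forall>B\<in>T. h ` B = B} \<and> \<not> q dvd m)"
  using T
proof (induction T rule: finite_induct)
  case empty
  have "\<not> q dvd 1" using q by (simp add: prime_nat_iff)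
  then show ?case using H by (auto intro: exI[of _ 1])
next
  case (insert B T)
  let ?K = "{h\<in>H. \<forall>B\<in>T. h ` B = B}" and ?K' = "{h\<in>H. \<forall>B\<in>insert B T. h ` B = B}"
  obtain m where K: "perm_group S ?K" and m: "card H = m * card ?K" "\<not> q dvd m" using insert by auto
  have eq: "?K' = {h\<in>?K. h ` B = B}" by auto
  define c where "c = card ((\<lambda>h. h ` B) ` ?K)"
  have cK: "c * card ?K' = card ?K" unfolding eq c_def
    using orbit_stabilizer[OF K S, of "(`)" B] by (simp add: image_comp)
  have "\<not> q dvd c"
  proof -
    have "(\<lambda>h. h ` B) ` ?K \<subseteq> P" using act insert.prems by auto
    then have "c \<le> card P" unfolding c_def by (rule card_mono[OF P(1)])
    moreover have "c > 0" unfolding c_def using finite_perm_group[OF K S] perm_groupD(2)[OF K]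
      by (auto simp: card_gt_0_iff)
    ultimately show ?thesis using P(2) by (auto dest: dvd_imp_le)
  qed
  then have "\<not> q dvd m * c" using m(2) q by (simp add: prime_dvd_mult_iff)
  moreover have "perm_group S ?K'" unfolding eq
    by (rule perm_group_stabilizer[OF K]) (auto simp: image_comp)
  moreover have "card H = (m * c) * card ?K'" using m(1) cK[symmetric] by simp
  ultimately show ?case by blast
qed

text \<open>With \<open>b\<close> blocks: if \<open>b < q\<close>, then fixing \<open>j\<close> blocks costs only an index prime to \<open>q\<close>, and their
union has \<open>card D * j\<close> points. If \<open>b \<ge> q\<close>, then there is a Jordan set of \<open>q ^ e\<close> points for the least
\<open>q ^ e > card D\<close>; no block contains it, so it is a union of blocks.\<close>

lemma imprimitive_prime_index:
  assumes S: "finite S" "3 \<le> card S" and H: "perm_group S H" "H \<subseteq> alternating S" "jordan_set H S"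
    and D: "D \<subseteq> S" "1 < card D" "block H D"
    and q: "prime q" "\<not> q dvd card (alternating S) div card H"
    and ab: "card S = card D * b"
  shows "(\<exists>i. card D = q ^ i) \<or> (\<forall>j\<le>b. \<not> q dvd (card S choose (card D * j)))"
proof -
  define P where "P = (\<lambda>h. h ` D) ` H"
  have trans: "\<forall>x\<in>S. \<forall>y\<in>S. \<exists>h\<in>H. h x = y"
    using H(3) by (auto simp: jordan_set_def supported_self[OF H(1)])
  have Dne: "D \<noteq> {}" using D(2) by auto
  note bt = block_translates[OF H(1) S(1) trans D(1) Dne D(3), folded P_def]
  have cP: "card P = b" using bt(6) ab D(2) by simp
  show ?thesis
  proof (cases "b < q")
    case True
    have G: "perm_group S (alternating S)" by (rule perm_group_alternating[OF S(1)])
    have "\<not> q dvd (card S choose (card D * j))" if j: "j \<le> b" for j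
    proof -
      obtain T where T: "T \<subseteq> P" "card T = j" "finite T"
        using obtain_subset_with_card_n[of j P] j cP by metis
      let ?K = "{h\<in>H. \<forall>B\<in>T. h ` B = B}" and ?U = "\<Union>T"
      obtain m where K: "perm_group S ?K" and m: "card H = m * card ?K" "\<not> q dvd m"
        using index_coprime_stabilizer_of_blocks[OF S(1) H(1) bt(2) _ q(1) bt(5) T(3,1)] True cP by auto
      have US: "?U \<subseteq> S" using T(1) bt(1) by blast
      have cU: "card ?U = card D * j"
        using card_partition[OF T(3) finite_subset[OF US S(1)], of "card D"] T(2)
          bt(3)[OF subsetD[OF T(1)]] bt(4)[OF subsetD[OF T(1)] subsetD[OF T(1)]] by simp
      let ?W = "{h\<in>alternating S. h ` ?U = ?U}"
      have W: "perm_group S ?W" by (rule perm_group_stabilizer[OF G]) (auto simp: image_comp)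
      have "?K \<subseteq> ?W"
      proof
        fix h assume h: "h \<in> ?K"
        then have "h ` ?U = ?U" by (simp add: image_Union)
        moreover have "h \<in> alternating S" using h H(2) by auto
        ultimately show "h \<in> ?W" by simp
      qed
      then obtain c where c: "card ?W = card ?K * c"
        using perm_group_lagrange[OF W K _ S(1)] unfolding dvd_def by blast
      let ?i = "card (alternating S) div card H"
      have "card H * ?i = card (alternating S)" using perm_group_lagrange[OF G H(1,2) S(1)] by simp
      \<comment> \<open>Both sides count the alternating group, through the set stabilizer
        \<open>?W\<close> and through \<open>H\<close>. Since \<open>q\<close> divides neither
        \<open>?i\<close> nor \<open>m\<close>, it cannot divide the binomial coefficient.\<close>
      then have "card ?K * ((card S choose (card D * j)) * c) = card ?K * (?i * m)"
        using card_set_stabilizer_alternating[OF S US] c m(1) cU by (simp add: mult_ac)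
      then have e: "(card S choose (card D * j)) * c = ?i * m" using card_perm_group_pos[OF K S(1)] by simp
      have "\<not> q dvd ?i * m" using q m(2) by (simp add: prime_dvd_mult_iff)
      then show ?thesis using e by (metis dvd_mult2)
    qed
    then show ?thesis by blast
  next
    case False
    have "card D < q ^ card D" using prime_gt_1_nat[OF q(1)] by (simp add: power_gt_expt)
    define e where "e = (LEAST e. card D < q ^ e)"
    have e: "card D < q ^ e" unfolding e_def by (rule LeastI) fact
    have e0: "e \<noteq> 0" using e D(2) by (intro notI) simp
    \<comment> \<open>Minimality gives \<open>q ^ (e - 1) \<le> card D\<close>, so
      \<open>q ^ e \<le> q * card D \<le> b * card D = card S\<close>, and the Jordan set fits into
      \<open>S\<close>.\<close>
    have "\<not> card D < q ^ (e - 1)" using not_less_Least[of "e - 1" "\<lambda>e. card D < q ^ e"] e0 by (simp add: e_def)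
    then have "q ^ e \<le> q * card D" using e0 by (cases e) auto
    also have "\<dots> \<le> card S" using False ab by simp
    finally obtain X where X: "X \<subseteq> S" "card X = q ^ e" "jordan_set H X"
      using jordan_set_of_prime_power_card[OF S(1) H(1,2) q, of e] e D(2) by auto
    \<comment> \<open>A point of \<open>B\<close> outside \<open>X\<close> is fixed by everything
      supported on \<open>X\<close>, so these elements all preserve \<open>B\<close>, and
      \<open>B\<close> would contain the larger set \<open>X\<close>.\<close>
    have in_X: "B \<subseteq> X" if B: "B \<in> P" "B \<inter> X \<noteq> {}" for B
    proof (rule ccontr)
      assume "\<not> B \<subseteq> X"
      then obtain z where z: "z \<in> B" "z \<notin> X" by blast
      obtain x where x: "x \<in> B" "x \<in> X" using B(2) by blast
      have "X \<subseteq> B"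
      proof
        fix y assume "y \<in> X"
        then obtain h where h: "h \<in> supported H X" "h x = y" using jordan_setE[OF X(3) x(2)] by blast
        have "h z = z" "h \<in> H" using h(1) z(2) by (auto simp: supported_def)
        then have "h ` B \<inter> B \<noteq> {}" using z(1) by (metis IntI empty_iff image_eqI)
        then have "h ` B = B" using bt(4)[OF bt(5)[OF \<open>h \<in> H\<close> B(1)] B(1)] by blast
        then show "y \<in> B" using h(2) x(1) by blast
      qed
      moreover have "finite B" using B(1) bt(1) S(1) by (metis Sup_upper finite_subset)
      ultimately have "card X \<le> card B" using card_mono by blast
      then show False using bt(3)[OF B(1)] X(2) e by simp
    qed
    define Q where "Q = {B\<in>P. B \<inter> X \<noteq> {}}"
    have "\<Union>Q = X"
    proof
      show "\<Union>Q \<subseteq> X" using in_X by (auto simp: Q_def)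
      show "X \<subseteq> \<Union>Q"
      proof
        fix x assume x: "x \<in> X"
        then obtain B where "B \<in> P" "x \<in> B" using bt(1) X(1) by blast
        then show "x \<in> \<Union>Q" using x unfolding Q_def by blast
      qed
    qed
    then have "card D * card Q = card X"
    proof (intro card_partition[of Q "card D", simplified \<open>\<Union>Q = X\<close>])
      show "finite Q" "finite X" using bt(2) finite_subset[OF X(1) S(1)] by (auto simp: Q_def)
      show "card B = card D" if "B \<in> Q" for B using that bt(3) by (simp add: Q_def)
      show "B \<inter> C = {}" if "B \<in> Q" "C \<in> Q" "B \<noteq> C" for B C using that bt(4) by (simp add: Q_def)
    qed
    then have "card D dvd q ^ e" using X(2) by (metis dvd_triv_left)
    then show ?thesis using divides_primepow_nat[OF q(1)] by blast
  qed
qed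

lemma primitive_of_binomials:
  assumes S: "finite S" "3 \<le> card S" and H: "perm_group S H" "H \<subseteq> alternating S" "jordan_set H S"
    and pr: "prime p" "prime r" "p \<noteq> r" and npp: "\<not> primepow (card S)"
    and bin: "\<And>k. 0 < k \<Longrightarrow> k < card S \<Longrightarrow> p dvd (card S choose k) \<or> r dvd (card S choose k)"
    and idx: "\<not> p dvd card (alternating S) div card H" "\<not> r dvd card (alternating S) div card H"
  shows "primitive_on H S"
  unfolding primitive_on_def
proof (intro conjI allI impI notI H(3))
  fix D assume D: "D \<subseteq> S \<and> 1 < card D \<and> card D < card S" and b: "block (supported H S) D"
  then have b: "block H D" by (simp add: supported_self[OF H(1)])
  have "\<forall>x\<in>S. \<forall>y\<in>S. \<exists>h\<in>H. h x = y"
    using H(3) by (auto simp: jordan_set_def supported_self[OF H(1)])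
  then obtain m where m: "card S = card D * m" using block_translates(6)[OF H(1) S(1) _ _ _ b] D by (metis card.empty not_less_zero)
  have m1: "1 < m" using D m by (cases m) auto
  note alt = imprimitive_prime_index[OF S H conjunct1[OF D] _ b _ _ m]
  \<comment> \<open>A power \<open>card D > 1\<close> of \<open>q\<close> is no power of
    \<open>s\<close>, so \<open>s\<close> divides none of the coefficients at multiples of
    \<open>card D\<close>. By \<open>bin'\<close> the prime \<open>q\<close> divides all of them
    strictly inside the range, hence all inner \<open>m choose j\<close>; this makes
    \<open>m\<close>, and then \<open>card S\<close>, a power of \<open>q\<close>.\<close>
  have fin: False if q: "prime q" "prime s" "q \<noteq> s" and qi: "card D = q ^ i"
    and s: "\<not> s dvd card (alternating S) div card H"
    and bin': "\<And>k. 0 < k \<Longrightarrow> k < card S \<Longrightarrow> q dvd (card S choose k) \<or> s dvd (card S choose k)" for q s i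
  proof -
    have "\<not> (\<exists>j. card D = s ^ j)"
      using q qi D by (metis prime_power_eq_one_iff less_irrefl prime_power_inj'' power_0 neq0_conv)
    then have ns: "\<And>j. j \<le> m \<Longrightarrow> \<not> s dvd (card S choose (card D * j))" using alt[OF _ q(2) s] D by blast
    have "q dvd (m choose j)" if j: "0 < j" "j < m" for j
    proof -
      have "q dvd (card S choose (card D * j))" using bin'[of "card D * j"] ns[of j] j D m by auto
      then show ?thesis using prime_dvd_binomial_mult_power[OF q(1), of j m i] j m qi by simp
    qed
    then obtain t where "m = q ^ t" using prime_power_if_dvd_binomials[OF q(1), of m] m1 by auto
    then have "card S = q ^ (i + t)" using m qi by (simp add: power_add)
    moreover have "i + t > 0" using calculation S(2) by (cases "i + t") auto
    ultimately have "primepow (card S)" using q(1) by (auto simp: primepow_def)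
    then show False using npp by simp
  qed
  consider i where "card D = p ^ i" | i where "card D = r ^ i"
    | "\<not> p dvd (card S choose (card D * 1))" "\<not> r dvd (card S choose (card D * 1))"
    using alt[OF _ pr(1) idx(1)] alt[OF _ pr(2) idx(2)] D m1 by (metis less_imp_le)
  then show False
  proof cases
    case 1 then show False using fin[OF pr _ idx(2)] bin by blast
  next
    case 2 then show False using fin[OF pr(2,1) pr(3)[symmetric] _ idx(1)] bin by blast
  next
    case 3 then show False using bin[of "card D"] D by auto
  qed
qed

section \<open>Primitive groups containing a cycle of prime length\<close>

text \<open>With \<open>card X = q\<close> the listed points are distinct, so \<open>c\<close> is a
  \<open>q\<close>-cycle on \<open>X\<close> with base point \<open>x\<close> and the identity
  elsewhere.\<close>

definition full_cycle :: "nat \<Rightarrow> 'a set \<Rightarrow> 'a \<Rightarrow> ('a \<Rightarrow> 'a) \<Rightarrow> bool" where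
  "full_cycle q X x c \<longleftrightarrow> c permutes X \<and> c ^^ q = id \<and> X = (\<lambda>i. (c ^^ i) x) ` {..<q} \<and> card X = q"

lemma full_cycleD:
  assumes "full_cycle q X x c"
  shows "c permutes X" "c ^^ q = id" "X = (\<lambda>i. (c ^^ i) x) ` {..<q}" "card X = q"
  using assms unfolding full_cycle_def by blast+

lemma funpow_mod_order:
  assumes "c ^^ q = id" shows "c ^^ (i mod q) = c ^^ i"
proof -
  have "c ^^ (q * (i div q)) = id" by (simp add: funpow_mult[symmetric] assms del: funpow_mult)
  then have "c ^^ (i mod q + q * (i div q)) = c ^^ (i mod q)" unfolding funpow_add by simp
  then show ?thesis by (simp only: mod_mult_div_eq)
qed

lemma perm_group_powers:
  assumes c: "full_cycle q X x c" "X \<subseteq> S" and q: "0 < q"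
  shows "perm_group S ((\<lambda>i. c ^^ i) ` {..<q})" "card ((\<lambda>i. c ^^ i) ` {..<q}) = q"
    "\<And>i. c ^^ i \<in> (\<lambda>i. c ^^ i) ` {..<q}"
proof -
  have id: "c ^^ q = id" and cp: "c permutes S" using c permutes_subset by (auto simp: full_cycle_def)
  show mem: "c ^^ i \<in> (\<lambda>i. c ^^ i) ` {..<q}" for i
    using funpow_mod_order[OF id, of i] q by (intro image_eqI[of _ _ "i mod q"]) auto
  have pw: "c ^^ i permutes S" for i
    by (induction i) (simp_all only: funpow.simps permutes_id permutes_compose cp)
  have "inv' (c ^^ i) \<in> (\<lambda>i. c ^^ i) ` {..<q}" if "i < q" for i
  proof -
    have "c ^^ (q - i) \<circ> c ^^ i = id" using that id by (simp flip: funpow_add)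
    then have "inv' (c ^^ i) = c ^^ (q - i)"
      using permutes_inv_o(1)[OF pw[of i]] by (metis comp_assoc comp_id id_comp)
    then show ?thesis using mem by simp
  qed
  moreover have "id \<in> (\<lambda>i. c ^^ i) ` {..<q}" using mem[of 0] by simp
  ultimately show "perm_group S ((\<lambda>i. c ^^ i) ` {..<q})"
    unfolding perm_group_def using pw mem by (auto simp flip: funpow_add)
  have "inj_on (\<lambda>i. (c ^^ i) x) {..<q}" using c(1) by (intro eq_card_imp_inj_on) (auto simp: full_cycle_def)
  then have "inj_on (\<lambda>i. c ^^ i) {..<q}" by (auto simp: inj_on_def)
  then show "card ((\<lambda>i. c ^^ i) ` {..<q}) = q" by (simp add: card_image)
qed

lemma full_cycle_exists:
  assumes "card X = q" "2 \<le> q"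
  shows "\<exists>x c. full_cycle q X x c"
proof -
  have "finite X" using assms by (intro card_ge_0_finite) simp
  then obtain f where f: "bij_betw f {0..<q} X" using ex_bij_betw_nat_finite assms(1) by metis
  define g where "g = inv_into {0..<q} f"
  have gf: "g (f i) = i" if "i < q" for i using f that by (simp add: g_def bij_betw_def inv_into_f_f)
  have fX: "f i \<in> X" if "i < q" for i using f that by (auto simp: bij_betw_def)
  have X: "X = f ` {..<q}" using f by (auto simp: bij_betw_def)
  define c where "c y = (if y \<in> X then f (Suc (g y) mod q) else y)" for y
  have cf: "c (f i) = f (Suc i mod q)" if "i < q" for i using that fX gf by (simp add: c_def)
  have pw: "(c ^^ j) (f i) = f ((i + j) mod q)" if "i < q" for i j
  proof (induction j)
    case (Suc j)
    have "(c ^^ Suc j) (f i) = c (f ((i + j) mod q))" using Suc by simp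
    also have "\<dots> = f (Suc ((i + j) mod q) mod q)" by (rule cf) (use assms in simp)
    finally show ?case by (simp add: mod_Suc_eq)
  qed (use that in simp)
  have out: "(c ^^ j) y = y" if "y \<notin> X" for j y
    by (induction j) (use that in \<open>auto simp: c_def\<close>)
  have cq: "c ^^ q = id"
  proof
    fix y show "(c ^^ q) y = id y" using pw[of _ q] out[of y q] X by (cases "y \<in> X") auto
  qed
  have "c ` X \<subseteq> X" using fX assms by (auto simp: c_def)
  moreover have "inj_on c X"
  proof (rule inj_on_inverseI[where g="c ^^ (q - 1)"])
    fix y assume "y \<in> X"
    have "(c ^^ (q - 1)) (c y) = (c ^^ Suc (q - 1)) y" by (simp add: funpow_swap1)
    then show "(c ^^ (q - 1)) (c y) = y" using cq assms by simp
  qed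
  ultimately have "bij_betw c X X" using \<open>finite X\<close> by (simp add: bij_betw_def endo_inj_surj)
  then have "c permutes X" by (rule bij_imp_permutes) (simp add: c_def)
  moreover have "X = (\<lambda>i. (c ^^ i) (f 0)) ` {..<q}" using pw[of 0] assms unfolding X by (auto intro!: image_cong)
  ultimately have "full_cycle q X (f 0) c" using cq assms by (simp add: full_cycle_def)
  then show ?thesis by blast
qed

lemma full_cycle_conj:
  fixes g :: "'a \<Rightarrow> 'a"
  assumes c: "full_cycle q X x c" and g: "bij g"
  shows "full_cycle q (inv' g ` X) (inv' g x) (inv' g \<circ> c \<circ> g)"
proof -
  let ?c = "inv' g \<circ> c \<circ> g"
  have gi: "g (inv' g y) = y" "inv' g (g y) = y" for y using g by (auto simp: bij_def surj_f_inv_f)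
  have pw: "?c ^^ i = inv' g \<circ> (c ^^ i) \<circ> g" for i
    by (induction i) (auto simp: fun_eq_iff gi)
  have inj: "inj (inv' g)" using g bij_imp_bij_inv bij_is_inj by blast
  have cp: "c permutes X" by (rule full_cycleD(1)[OF c])
  have "?c permutes (inv' g ` X)"
  proof (rule bij_imp_permutes)
    have "?c ` inv' g ` X = inv' g ` c ` X" by (auto simp: image_image gi)
    then have "?c ` inv' g ` X = inv' g ` X" using permutes_image[OF cp] by simp
    moreover have "inj ?c" using inj permutes_inj[OF cp] bij_is_inj[OF g] by (simp add: inj_compose)
    ultimately show "bij_betw ?c (inv' g ` X) (inv' g ` X)"
      unfolding bij_betw_def using inj_on_subset[OF _ subset_UNIV] by blast
    fix y assume "y \<notin> inv' g ` X"
    then have "g y \<notin> X" using gi by (metis image_eqI)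
    then show "?c y = y" using permutes_not_in[OF cp] gi by simp
  qed
  moreover have "?c ^^ q = id" using c gi by (auto simp: pw full_cycle_def fun_eq_iff)
  moreover have "inv' g ` X = (\<lambda>i. (?c ^^ i) (inv' g x)) ` {..<q}"
    using c unfolding pw full_cycle_def by (auto simp: gi image_image)
  moreover have "card (inv' g ` X) = q"
    using card_image[OF inj_on_subset[OF inj subset_UNIV]] full_cycleD(4)[OF c] by metis
  ultimately show ?thesis by (simp add: full_cycle_def)
qed

text \<open>Odd powers of an odd permutation are odd, whereas \<open>c ^^ q\<close> is the
  identity.\<close>

lemma full_cycle_even:
  assumes c: "full_cycle q X x c" and q: "odd q"
  shows "evenperm c"
proof -
  have "finite X" using c q by (intro card_ge_0_finite) (auto simp: full_cycle_def intro: odd_pos)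
  then have p: "permutation c" using c by (auto simp: full_cycle_def intro: permutes_imp_permutation)
  have pw: "permutation (c ^^ i) \<and> evenperm (c ^^ i) = (even i \<or> evenperm c)" for i
  proof (induction i)
    case (Suc i)
    have "evenperm (c \<circ> c ^^ i) = (evenperm c = evenperm (c ^^ i))"
      by (rule evenperm_comp) (use p Suc in auto)
    moreover have "permutation (c \<circ> c ^^ i)" by (rule permutation_compose) (use p Suc in auto)
    ultimately show ?case using Suc by (simp only: funpow.simps) auto
  qed simp
  have "evenperm (c ^^ q)" using c by (simp add: full_cycle_def)
  then show ?thesis using pw[of q] q by simp
qed

text \<open>For odd \<open>q\<close> a \<open>q\<close>-cycle lies in the alternating group and
  generates a subgroup of order \<open>q\<close>, which some conjugate of \<open>H\<close> contains.
  Conjugating back gives a cycle in \<open>H\<close>.\<close>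

lemma cycle_of_prime_index:
  assumes S: "finite S" and H: "perm_group S H" "H \<subseteq> alternating S"
    and q: "prime q" "odd q" "q \<le> card S" "\<not> q dvd card (alternating S) div card H"
  shows "\<exists>X x c. X \<subseteq> S \<and> full_cycle q X x c \<and> c \<in> H"
proof -
  have G: "perm_group S (alternating S)" by (rule perm_group_alternating[OF S])
  obtain Y where Y: "Y \<subseteq> S" "card Y = q" using obtain_subset_with_card_n[OF q(3)] by metis
  obtain x c where c: "full_cycle q Y x c" using full_cycle_exists[OF Y(2)] prime_ge_2_nat[OF q(1)] by blast
  let ?K = "(\<lambda>i. c ^^ i) ` {..<q}"
  note K = perm_group_powers[OF c Y(1) prime_gt_0_nat[OF q(1)]]
  have "c \<in> alternating S" using c full_cycle_even[OF c q(2)] permutes_subset[OF _ Y(1)]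
    by (auto simp: alternating_def full_cycle_def)
  then have KG: "?K \<subseteq> alternating S" using perm_group_funpow[OF G] by auto
  obtain g where g: "g \<in> alternating S" "\<And>k. k \<in> ?K \<Longrightarrow> inv' g \<circ> k \<circ> g \<in> H"
    using conjugate_into_of_prime_card[OF G H K(1) KG S q(4,1) K(2)] by blast
  have "c \<in> ?K" using K(3)[of 1] by simp
  then have "inv' g \<circ> c \<circ> g \<in> H" using g(2) by blast
  moreover have gp: "g permutes S" by (rule perm_groupD(1)[OF G g(1)])
  moreover have "inv' g ` Y \<subseteq> S" using Y(1) permutes_image[OF permutes_inv[OF gp]] by blast
  ultimately show ?thesis using full_cycle_conj[OF c permutes_bij[OF gp]] by blast
qed

lemma jordan_set_of_full_cycle:
  assumes H: "perm_group S H" and c: "full_cycle q X x c" "c \<in> H"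
  shows "jordan_set H X"
proof -
  let ?L = "supported H X"
  have L: "perm_group X ?L" by (rule perm_group_supported(1)[OF H])
  have "c \<in> ?L" using c permutes_not_in by (fastforce simp: supported_def full_cycle_def)
  then have pw: "c ^^ i \<in> ?L" for i by (rule perm_group_funpow[OF L])
  show ?thesis unfolding jordan_set_def
  proof (intro ballI)
    fix y z assume "y \<in> X" "z \<in> X"
    then obtain i j where ij: "y = (c ^^ i) x" "z = (c ^^ j) x" using c(1) by (auto simp: full_cycle_def)
    let ?h = "c ^^ j \<circ> inv' (c ^^ i)"
    have "?h \<in> ?L" using pw by (intro perm_groupD(3,4)[OF L])
    moreover have "?h y = z" using ij perm_group_comp_inv(3)[OF L pw] by simp
    ultimately show "\<exists>h\<in>?L. h y = z" by blast
  qed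
qed

text \<open>The Frattini argument: \<open>\<langle>c\<rangle>\<close> is a Sylow subgroup of the pointwise stabilizer of \<open>S - X\<close>.\<close>

lemma normalizing_lift:
  assumes S: "finite S" and H: "perm_group S H" and X: "X \<subseteq> S"
    and c: "full_cycle q X x c" "c \<in> H" and q: "prime q" and g: "g \<in> H" "g ` X = X"
  shows "\<exists>y\<in>H. (\<forall>z. z \<notin> X \<longrightarrow> y z = g z) \<and> (\<exists>i. y \<circ> c = c ^^ i \<circ> y)"
proof -
  let ?G = "supported H X" and ?P = "(\<lambda>i. c ^^ i) ` {..<q}"
  have fX: "finite X" using X S finite_subset by blast
  have cX: "card X = q" and cp: "c permutes X" using full_cycleD[OF c(1)] by blast+
  have G: "perm_group X ?G" by (rule perm_group_supported(1)[OF H])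
  have q0: "0 < q" using q by (rule prime_gt_0_nat)
  note P = perm_group_powers[OF c(1) order_refl q0]
  have cG: "c \<in> ?G" using c(2) permutes_not_in[OF cp] by (simp add: supported_def)
  have PG: "?P \<subseteq> ?G" using perm_group_funpow[OF G cG] by auto
  have gi: "bij (inv' g)" using permutes_bij[OF permutes_inv[OF perm_groupD(1)[OF H g(1)]]] .
  have gg: "inv' (inv' g) = g" by (rule permutes_inv_inv[OF perm_groupD(1)[OF H g(1)]])
  let ?d = "g \<circ> c \<circ> inv' g"
  have d: "full_cycle q X (g x) ?d" using full_cycle_conj[OF c(1) gi] gg g(2) by simp
  have dG: "?d \<in> ?G"
  proof -
    have "?d \<in> H" using g(1) c(2) by (auto intro!: perm_groupD(3,4)[OF H])
    moreover have "?d permutes X" by (rule full_cycleD(1)[OF d])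
    ultimately show ?thesis using permutes_not_in[of ?d X] unfolding supported_def by blast
  qed
  let ?K = "(\<lambda>i. ?d ^^ i) ` {..<q}"
  note K = perm_group_powers[OF d order_refl q0]
  have KG: "?K \<subseteq> ?G" using perm_group_funpow[OF G dG] by auto
  \<comment> \<open>A group on \<open>q\<close> points has order dividing \<open>fact q\<close>,
    which is not divisible by \<open>q * q\<close>, while \<open>card ?P = q\<close>.\<close>
  have "\<not> q dvd card ?G div card ?P"
  proof
    assume a: "q dvd card ?G div card ?P"
    have "card ?P dvd card ?G" by (rule perm_group_lagrange[OF G P(1) PG fX])
    then have "q * q dvd card ?G" using a P(2) by (metis dvd_div_mult_self dvd_refl mult_dvd_mono)
    moreover have "card ?G dvd fact q"
    proof -
      have "perm_group X {h. h permutes X}" unfolding perm_group_def by (auto simp: permutes_compose permutes_inv)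
      from perm_group_lagrange[OF this G _ fX] show ?thesis
        using perm_groupD(1)[OF G] card_permutations[OF cX fX] by auto
    qed
    ultimately have "q * q dvd fact q" by (rule dvd_trans)
    moreover have "fact q = q * fact (q - 1)" using fact_reduce[of q, where ?'a=nat] q0 by simp
    ultimately have "q dvd fact (q - 1)" using q0 by simp
    then show False using q q0 by (simp add: prime_dvd_fact_iff)
  qed
  then obtain u where u: "u \<in> ?G" "\<And>k. k \<in> ?K \<Longrightarrow> inv' u \<circ> k \<circ> u \<in> ?P"
    using conjugate_into_of_prime_card[OF G P(1) PG K(1) KG fX _ q K(2)] by blast
  have uH: "u \<in> H" using u(1) by (simp add: supported_def)
  \<comment> \<open>\<open>inv' u\<close> conjugates \<open>g c g^-1\<close> into the powers of
    \<open>c\<close>, so \<open>?y\<close> conjugates \<open>c\<close> to a power of itself; as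
    \<open>u\<close> is supported on \<open>X\<close>, \<open>?y\<close> still agrees with
    \<open>g\<close> off \<open>X\<close>.\<close>
  let ?y = "inv' u \<circ> g"
  have "?d \<in> ?K" using K(3)[of 1] by simp
  then obtain i where i: "inv' u \<circ> ?d \<circ> u = c ^^ i" using u(2) by blast
  have "?y \<circ> c = (inv' u \<circ> ?d \<circ> u) \<circ> ?y"
    using perm_group_comp_inv(3)[OF H g(1)] perm_group_comp_inv(4)[OF G u(1)] by (simp add: fun_eq_iff)
  then have "?y \<circ> c = c ^^ i \<circ> ?y" using i by simp
  moreover have "?y \<in> H" using uH g(1) by (auto intro!: perm_groupD(3,4)[OF H])
  moreover have "?y z = g z" if "z \<notin> X" for z
  proof -
    have "g z \<notin> X" using that g(2) permutes_inj[OF perm_groupD(1)[OF H g(1)]] by (metis inj_image_mem_iff)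
    then show ?thesis using perm_groupD(4)[OF G u(1)] by (simp add: supported_def)
  qed
  ultimately show ?thesis by blast
qed

text \<open>If \<open>z x = (c ^^ i) x\<close>, then commuting with \<open>c\<close> forces
  \<open>z = c ^^ i\<close> on all of \<open>X\<close>, so \<open>z ^^ q\<close> acts there as
  \<open>c ^^ (i * q) = id\<close>.\<close>

lemma commuting_with_cycle:
  assumes c: "full_cycle q X x c" and z: "z \<circ> c = c \<circ> z" "z x \<in> X"
  shows "\<forall>y\<in>X. (z ^^ q) y = y"
proof
  fix y assume y: "y \<in> X"
  obtain i where i: "z x = (c ^^ i) x" using z(2) c by (auto simp: full_cycle_def)
  have cp: "c permutes X" by (rule full_cycleD(1)[OF c])
  have zc: "z ((c ^^ j) w) = (c ^^ j) (z w)" for j w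
  proof (induction j)
    case (Suc j)
    have "z (c v) = c (z v)" for v using fun_cong[OF z(1), of v] by simp
    then show ?case using Suc by simp
  qed simp
  have on_X: "z w = (c ^^ i) w" if w: "w \<in> X" for w
  proof -
    obtain j where j: "w = (c ^^ j) x" using w full_cycleD(3)[OF c] by blast
    have "z w = (c ^^ j) ((c ^^ i) x)" using zc i j by simp
    also have "\<dots> = (c ^^ i) w" using j by (metis add.commute comp_apply funpow_add)
    finally show ?thesis .
  qed
  have "(z ^^ m) y = (c ^^ (i * m)) y" for m
  proof (induction m)
    case (Suc m)
    have "(c ^^ (i * m)) y \<in> X" by (rule permutes_in_funpow_image[OF cp y])
    then show ?case using Suc on_X by (simp add: funpow_add)
  qed simp
  moreover have "c ^^ (i * q) = id"
    using funpow_mod_order[OF full_cycleD(2)[OF c], of "i * q"] by (simp add: id_def)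
  ultimately show "(z ^^ q) y = y" by simp
qed

text \<open>Jordan's theorem on prime cycles. Elements \<open>a\<close>, \<open>b\<close> of
  \<open>H\<close> act outside \<open>X\<close> as overlapping transpositions and normalize the
  powers of \<open>c\<close>. Both products conjugate \<open>c\<close> to
  \<open>c ^^ (i * j)\<close>, so the commutator \<open>z\<close> commutes with \<open>c\<close>. It
  is a 3-cycle outside \<open>X\<close>; for \<open>q \<noteq> 3\<close> the power
  \<open>z ^^ q\<close> still is one and fixes \<open>X\<close> pointwise.\<close>

lemma jordan_prime_cycle:
  assumes S: "finite S" and H: "perm_group S H" "H \<subseteq> alternating S" and prim: "primitive_on H S"
    and X: "X \<subseteq> S" and c: "full_cycle q X x c" "c \<in> H" and q: "prime q" "q + 3 \<le> card S"
  shows "alternating S \<subseteq> H"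
proof (cases "q = 3")
  case True
  show ?thesis by (rule alternating_subset_of_jordan_three[OF S H(1) prim jordan_set_of_full_cycle[OF H(1) c] X _ H(2)])
    (use full_cycleD(4)[OF c(1)] True in simp)
next
  case False
  have cX: "card X = q" by (rule full_cycleD(4)[OF c(1)])
  have jX: "primitive_on H X"
    using primitive_on_of_prime_card[OF H(1) jordan_set_of_full_cycle[OF H(1) c]] cX q(1) by simp
  have J: "jordan_set H Y" if "Y \<subseteq> S" "q < card Y" for Y
    using all_large_sets_jordan[OF H(1) S prim jX X _ that(1)] that(2) cX prime_gt_1_nat[OF q(1)] by simp
  obtain xs where xs: "set xs = S - X" "distinct xs" using finite_distinct_list[of "S - X"] S by auto
  have len: "length xs = card S - q"
    using distinct_card[OF xs(2)] xs(1) cX card_Diff_subset[OF finite_subset[OF X S] X] by simp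
  then obtain d1 d2 d3 ys where ys: "xs = d1 # d2 # d3 # ys" using q(2)
    by (cases xs; cases "tl xs"; cases "tl (tl xs)") auto
  \<comment> \<open>\<open>H\<close> is transitive on tuples of \<open>card S - q\<close> points, so
    it realizes every permutation of \<open>S - X\<close>; the Frattini argument then makes the lift
    normalize the powers of \<open>c\<close>.\<close>
  have lift: "\<exists>y\<in>H. (\<forall>z. z \<in> S - X \<longrightarrow> y z = s z) \<and> (\<exists>i. y \<circ> c = c ^^ i \<circ> y)"
    if s: "s permutes (S - X)" for s
  proof -
    have "\<exists>g\<in>H. map g xs = map s xs"
    proof (rule tuple_transitive[OF H(1) S J])
      show "distinct (map s xs)" using xs(2) permutes_inj_on[OF s] by (simp add: distinct_map)
      show "set (map s xs) \<subseteq> S" using xs(1) permutes_in_image[OF s] by auto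
    qed (use xs len q(2) in auto)
    then obtain g where g: "g \<in> H" "\<And>z. z \<in> S - X \<Longrightarrow> g z = s z" using xs(1) by (auto simp: map_eq_conv)
    have gp: "g permutes S" by (rule perm_groupD(1)[OF H(1) g(1)])
    have "g ` (S - X) = S - X" using image_cong[OF refl g(2), of "S - X"] permutes_image[OF s] by simp
    then have "S - g ` X = S - X" using image_set_diff[OF permutes_inj[OF gp], of S X] permutes_image[OF gp] by simp
    moreover have "g ` X \<subseteq> S" using X permutes_image[OF gp] by blast
    ultimately have "g ` X = X" using X by blast
    then show ?thesis using normalizing_lift[OF S H(1) X c q(1) g(1)] g(2) by (metis DiffD2)
  qed
  have dS: "d1 \<in> S - X" "d2 \<in> S - X" "d3 \<in> S - X" and dd: "d1 \<noteq> d2" "d1 \<noteq> d3" "d2 \<noteq> d3"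
    using xs ys by auto
  let ?s = "transpose d1 d2" and ?t = "transpose d2 d3"
  have sp: "?s permutes (S - X)" and tp: "?t permutes (S - X)" using dS by (auto intro: permutes_swap_id)
  obtain a i where a: "a \<in> H" "\<And>z. z \<in> S - X \<Longrightarrow> a z = ?s z" "a \<circ> c = c ^^ i \<circ> a" using lift[OF sp] by blast
  obtain b j where b: "b \<in> H" "\<And>z. z \<in> S - X \<Longrightarrow> b z = ?t z" "b \<circ> c = c ^^ j \<circ> b" using lift[OF tp] by blast
  have push: "h ((c ^^ m) v) = (c ^^ (k * m)) (h v)" if hk: "h \<circ> c = c ^^ k \<circ> h" for h k m v
  proof (induction m)
    case (Suc m)
    have "h (c w) = (c ^^ k) (h w)" for w using fun_cong[OF hk, of w] by simp
    then show ?case using Suc by (simp add: funpow_add)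
  qed simp
  have ab: "(a \<circ> b) \<circ> c = c ^^ (i * j) \<circ> (a \<circ> b)"
  proof
    fix v show "((a \<circ> b) \<circ> c) v = (c ^^ (i * j) \<circ> (a \<circ> b)) v"
      using fun_cong[OF b(3), of v] push[OF a(3), of j "b v"] by simp
  qed
  have ba: "(b \<circ> a) \<circ> c = c ^^ (i * j) \<circ> (b \<circ> a)"
  proof
    fix v show "((b \<circ> a) \<circ> c) v = (c ^^ (i * j) \<circ> (b \<circ> a)) v"
      using fun_cong[OF a(3), of v] push[OF b(3), of i "a v"] by (simp add: mult.commute)
  qed
  have baH: "b \<circ> a \<in> H" and abH: "a \<circ> b \<in> H" using a(1) b(1) perm_groupD(3)[OF H(1)] by auto
  define z where "z = inv' (b \<circ> a) \<circ> (a \<circ> b)"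
  have zH: "z \<in> H" unfolding z_def using a(1) b(1) by (intro perm_groupD(3,4)[OF H(1)])
  have zc: "z \<circ> c = c \<circ> z"
  proof
    fix v
    have "(b \<circ> a) (c (z v)) = (c ^^ (i * j)) ((b \<circ> a) (z v))" using fun_cong[OF ba, of "z v"] by simp
    also have "(b \<circ> a) (z v) = (a \<circ> b) v" unfolding z_def using perm_group_comp_inv(4)[OF H(1) baH] by simp
    also have "(c ^^ (i * j)) ((a \<circ> b) v) = (a \<circ> b) (c v)" using fun_cong[OF ab, of v] by simp
    finally have "inv' (b \<circ> a) ((a \<circ> b) (c v)) = c (z v)" using perm_group_comp_inv(3)[OF H(1) baH] by metis
    then show "(z \<circ> c) v = (c \<circ> z) v" by (simp add: z_def)
  qed
  have zD: "z v = (inv' (?t \<circ> ?s) \<circ> (?s \<circ> ?t)) v" if v: "v \<in> S - X" for v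
  proof -
    let ?w = "(inv' (?t \<circ> ?s) \<circ> (?s \<circ> ?t)) v"
    have tsp: "?t \<circ> ?s permutes (S - X)" and stp: "?s \<circ> ?t permutes (S - X)"
      using sp tp by (auto intro: permutes_compose)
    have w: "?w \<in> S - X" using permutes_in_image[OF permutes_inv[OF tsp]] permutes_in_image[OF stp] v by simp
    have "(b \<circ> a) ?w = (?t \<circ> ?s) ?w" using a(2)[OF w] b(2)[of "?s ?w"] permutes_in_image[OF sp] w by simp
    also have "\<dots> = (?s \<circ> ?t) v" using permutes_inverses(1)[OF tsp] by simp
    also have "\<dots> = (a \<circ> b) v" using b(2)[OF v] a(2)[of "?t v"] permutes_in_image[OF tp] v by simp
    finally have "(b \<circ> a) ?w = (b \<circ> a) (z v)" unfolding z_def using perm_group_comp_inv(4)[OF H(1) baH] by simp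
    then have "?w = z v" by (rule injD[OF permutes_inj[OF perm_groupD(1)[OF H(1) baH]]])
    then show ?thesis by (rule sym)
  qed
  \<comment> \<open>So the commutator acts outside \<open>X\<close> as
    \<open>(?s \<circ> ?t) \<circ> (?s \<circ> ?t)\<close>, the square of a 3-cycle.\<close>
  have inv_eq: "inv' (?t \<circ> ?s) = ?s \<circ> ?t"
    by (rule inv_unique_comp) (auto simp: fun_eq_iff)
  have z1: "z d1 = d3" "z d3 = d2" "z d2 = d1" and zfix: "\<And>v. v \<in> S - X \<Longrightarrow> v \<notin> {d1, d2, d3} \<Longrightarrow> z v = v"
    using zD dS dd unfolding inv_eq by (auto simp: transpose_def)
  have xX: "x \<in> X" using c(1) prime_gt_0_nat[OF q(1)] by (force simp: full_cycle_def)
  have zX: "z x \<in> X"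
  proof (rule ccontr)
    have zp: "z permutes S" by (rule perm_groupD(1)[OF H(1) zH])
    assume "z x \<notin> X"
    then have "z x \<in> S - X" using permutes_in_image[OF zp] xX X by blast
    moreover have "\<exists>v\<in>S - X. z v = w" if "w \<in> S - X" for w
      using that z1 zfix dS by (cases "w \<in> {d1, d2, d3}") auto
    ultimately obtain v where "v \<in> S - X" "z v = z x" by blast
    then show False using permutes_inj[OF zp] xX by (auto dest: injD)
  qed
  let ?h = "z ^^ q"
  have hX: "\<forall>y\<in>X. ?h y = y" by (rule commuting_with_cycle[OF c(1) zc zX])
  have hfix: "?h v = v" if "v \<noteq> d1" "v \<noteq> d2" "v \<noteq> d3" for v
  proof (cases "v \<in> X")
    case True then show ?thesis using hX by blast
  next
    case False
    have "z v = v" using zfix[of v] that False permutes_not_in[OF perm_groupD(1)[OF H(1) zH]] by blast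
    then show ?thesis by (induction q) auto
  qed
  have "?h d1 \<noteq> d1"
  proof -
    have "q mod 3 \<noteq> 0" using False q(1) by (auto simp: prime_nat_iff mod_eq_0_iff_dvd)
    then have "q mod 3 = 1 \<or> q mod 3 = 2" by linarith
    moreover have "(z ^^ (3 * m)) d1 = d1" for m by (induction m) (auto simp: z1 numeral_3_eq_3)
    then have "(z ^^ (q mod 3 + 3 * (q div 3))) d1 = (z ^^ (q mod 3)) d1" unfolding funpow_add by simp
    then have "?h d1 = (z ^^ (q mod 3)) d1" by (simp only: mod_mult_div_eq)
    ultimately show ?thesis using z1 dd by (auto simp: numeral_2_eq_2)
  qed
  then have "?h \<noteq> id" by (metis id_apply)
  from jordan_set_of_three_point_element[OF H perm_group_funpow[OF H(1) zH] this hfix]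
  show ?thesis using alternating_subset_of_jordan_three[OF S H(1) prim _ _ _ H(2)] dS by blast
qed

section \<open>Jordan sets of size four\<close>

text \<open>Arises from Jordan sets of size four: \<open>{x, y1, y2, y3}\<close> is one of them, and \<open>R y w z\<close> says that
\<open>{x, y, w, z}\<close> is another. Any two of them meet in an even number of points.\<close>

lemma no_even_pair_system:
  fixes R :: "'a \<Rightarrow> 'b \<Rightarrow> 'b \<Rightarrow> bool"
  assumes y: "y1 \<noteq> y2" "y1 \<noteq> y3" "y2 \<noteq> y3" and U: "5 \<le> card U"
    and sym: "\<And>y w z. R y w z \<Longrightarrow> R y z w"
    and dom: "\<And>y w z. R y w z \<Longrightarrow> y = y1 \<or> y = y2 \<or> y = y3"
    and irr: "\<And>y w z. R y w z \<Longrightarrow> w \<noteq> z"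
    and same: "\<And>y w z w' z'. R y w z \<Longrightarrow> R y w' z' \<Longrightarrow> w \<in> {w', z'} \<longleftrightarrow> z \<in> {w', z'}"
    and diff: "\<And>y y' w z w' z'. y \<noteq> y' \<Longrightarrow> R y w z \<Longrightarrow> R y' w' z' \<Longrightarrow> w \<in> {w', z'} \<longleftrightarrow> z \<notin> {w', z'}"
    and cover: "\<And>w. w \<in> U \<Longrightarrow> \<exists>y z. R y w z"
    and ex: "\<And>y. y \<in> {y1, y2, y3} \<Longrightarrow> \<exists>w z. R y w z"
  shows False
proof -
  have pick: "\<exists>w\<in>U. w \<notin> A" if "finite A" "card A < 5" for A
    using that U by (metis card_mono le_trans not_less subsetI)
  have small: "card {a, b, c, d} < 5" for a b c d :: 'b
    using card_length[of "[a, b, c, d]"] by simp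
  obtain a0 b0 where r1: "R y1 a0 b0" using ex by blast
  obtain c0 d0 where r2: "R y2 c0 d0" using ex by blast
  have "a0 = c0 \<or> a0 = d0 \<or> b0 = c0 \<or> b0 = d0" using diff[OF y(1) r1 r2] by auto
  then obtain a b c where ab: "R y1 a b" and ac: "R y2 a c"
    using r1 r2 sym[OF r1] sym[OF r2] by blast
  obtain e0 f0 where r3: "R y3 e0 f0" using ex by blast
  have abc: "a \<noteq> b" "a \<noteq> c" "b \<noteq> c" using irr ab ac diff[OF y(1) ab ac] by auto
  \<comment> \<open>Read each pair as an edge: the edges for \<open>y1\<close>, \<open>y2\<close>,
    \<open>y3\<close> meet pairwise in one point, so they form a star with centre \<open>a\<close>
    or the triangle on \<open>a\<close>, \<open>b\<close>, \<open>c\<close>.\<close>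
  have "(\<exists>d. R y3 a d) \<or> R y3 b c"
  proof -
    have "a = e0 \<or> a = f0 \<or> (b = e0 \<and> c = f0) \<or> (b = f0 \<and> c = e0)"
      using diff[OF y(2) ab r3] diff[OF y(3) ac r3] abc by auto
    then show ?thesis using r3 sym[OF r3] by blast
  qed
  then show False
  proof
    assume "\<exists>d. R y3 a d"
    then obtain d where ad: "R y3 a d" by blast
    \<comment> \<open>Star: the edge at a new point \<open>w\<close> must meet the two edges of
      other kinds in one point each, which forces its other end to be \<open>a\<close>; then it
      meets the edge of its own kind in just one point.\<close>
    obtain w where w: "w \<in> U" "w \<notin> {a, b, c, d}" using pick[OF _ small, of a b c d] by auto
    obtain y z where r: "R y w z" using cover[OF w(1)] by blast
    from dom[OF r] show False
    proof (elim disjE)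
      assume e: "y = y1"
      then have "z \<in> {a, c}" "z \<in> {a, d}" using diff[OF _ r ac] diff[OF _ r ad] y w(2) by auto
      then show False using same[OF r[unfolded e] ab] w(2) diff[OF y(3) ac ad] abc by auto
    next
      assume e: "y = y2"
      then have "z \<in> {a, b}" "z \<in> {a, d}" using diff[OF _ r ab] diff[OF _ r ad] y w(2) by auto
      then show False using same[OF r[unfolded e] ac] w(2) diff[OF y(2) ab ad] abc by auto
    next
      assume e: "y = y3"
      then have "z \<in> {a, b}" "z \<in> {a, c}" using diff[OF _ r ab] diff[OF _ r ac] y w(2) by auto
      then show False using same[OF r[unfolded e] ad] w(2) abc by auto
    qed
  next
    assume bc: "R y3 b c"
    obtain w where w: "w \<in> U" "w \<notin> {a, b, c}" using pick[OF _ small, of a a b c] by auto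
    obtain w' where w': "w' \<in> U" "w' \<notin> {a, b, c, w}" using pick[OF _ small, of a b c w] by auto
    obtain y z where r: "R y w z" using cover[OF w(1)] by blast
    obtain y' z' where r': "R y' w' z'" using cover[OF w'(1)] by blast
    \<comment> \<open>Triangle: a new point is joined to the vertex opposite the edge of its kind.
      Two new points then give edges of the same kind sharing one end, or disjoint edges of
      different kinds, both excluded.\<close>
    have opp: "y = y1 \<and> z = c \<or> y = y2 \<and> z = b \<or> y = y3 \<and> z = a"
      if r: "R y w z" and w: "w \<notin> {a, b, c}" for y w z
      using dom[OF r]
    proof (elim disjE)
      assume "y = y1" then show ?thesis using diff[OF _ r ac] diff[OF _ r bc] y w abc by auto
    next
      assume "y = y2" then show ?thesis using diff[OF _ r ab] diff[OF _ r bc] y w abc by auto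
    next
      assume "y = y3" then show ?thesis using diff[OF _ r ab] diff[OF _ r ac] y w abc by auto
    qed
    show False
    proof (cases "y = y'")
      case True
      then have "z = z'" using opp[OF r w(2)] opp[OF r'] w'(2) y by auto
      then show False using same[OF r r'[folded True]] w'(2) opp[OF r w(2)] w(2) by auto
    next
      case False
      then show False using diff[OF False r r'] opp[OF r w(2)] opp[OF r'] w(2) w'(2) abc y by auto
    qed
  qed
qed

text \<open>If two Jordan sets of size four meet in one or three points, then double transpositions on them yield
a 3-cycle (as a commutator or as a product).\<close>

lemma jordan_four_sets:
  assumes S: "finite S" and H: "perm_group S H" "H \<subseteq> alternating S" and prim: "primitive_on H S"
    and J: "\<And>Y. Y \<subseteq> S \<Longrightarrow> card S - 2 < card Y \<Longrightarrow> jordan_set H Y"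
    and X: "X \<subseteq> S" "card X = 4" "jordan_set H X" and n: "card S = 6 \<or> 9 \<le> card S"
  shows "alternating S \<subseteq> H"
proof (rule ccontr)
  assume no: "\<not> alternating S \<subseteq> H"
  have no3: "h = id" if "h \<in> H" "{a, b, c} \<subseteq> S" "\<And>z. z \<noteq> a \<Longrightarrow> z \<noteq> b \<Longrightarrow> z \<noteq> c \<Longrightarrow> h z = z" for h a b c
    using jordan_set_of_three_point_element[OF H that(1) _ that(3), of a b c]
      alternating_subset_of_jordan_three[OF S H(1) prim _ that(2) _ H(2)] no by blast
  define F where "F X \<longleftrightarrow> X \<subseteq> S \<and> card X = 4 \<and> jordan_set H X" for X
  have Fim: "F (h ` Y)" if "F Y" "h \<in> H" for h Y
  proof -
    have p: "h permutes S" by (rule perm_groupD(1)[OF H(1) that(2)])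
    have "h ` Y \<subseteq> S" using that(1) permutes_image[OF p] by (auto simp: F_def)
    then show ?thesis using that jordan_set_image[OF H(1) that(2)] card_image[OF permutes_inj_on[OF p]]
      by (simp add: F_def)
  qed
  \<comment> \<open>The elements of \<open>H\<close> supported on these four points are even,
    transitive and include no 3-cycle, so they form the Klein four-group. It is shown that an
    \<open>h\<close> with \<open>h a = b\<close> swaps \<open>a\<close> and \<open>b\<close>, and
    hence \<open>c\<close> and \<open>d\<close>.\<close>
  have dt: "transpose a b \<circ> transpose c d \<in> H" if F: "F {a, b, c, d}" and dist: "distinct [a, b, c, d]" for a b c d
  proof -
    have sub: "{a, b, c, d} \<subseteq> S" using F by (simp add: F_def)
    obtain h where h: "h \<in> supported H {a, b, c, d}" "h a = b"
      using F jordan_setE[of H "{a, b, c, d}" a b] by (auto simp: F_def)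
    have hH: "h \<in> H" and out: "\<And>z. z \<notin> {a, b, c, d} \<Longrightarrow> h z = z" using h(1) by (auto simp: supported_def)
    have hp: "h permutes {a, b, c, d}" by (rule supported_permutes[OF H(1) h(1)])
    have inj: "h u = h v \<longleftrightarrow> u = v" for u v using permutes_inj[OF hp] by (auto dest: injD)
    have into: "h u \<in> {a, b, c, d}" if "u \<in> {a, b, c, d}" for u using permutes_in_image[OF hp] that by blast
    have G: "perm_group S (alternating S)" by (rule perm_group_alternating[OF S])
    have hG: "h \<in> alternating S" using hH H(2) by blast
    \<comment> \<open>Otherwise \<open>h\<close> is a 3-cycle or a 4-cycle. The latter is odd:
      multiplied by \<open>(a b)(c' d')\<close> it moves just \<open>b\<close> and
      \<open>d'\<close>.\<close>
    have nc: "h b \<noteq> c'" if cd: "{c', d'} = {c, d}" "c' \<noteq> d'" for c' d'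
    proof
      assume hb: "h b = c'"
      have d: "distinct [a, b, c', d']" and set: "{a, b, c, d} = {a, b, c', d'}" using cd dist by auto
      have "h c' \<in> {a, b, c', d'}" using into[of c'] set by auto
      then have "h c' = a \<or> h c' = d'" using inj[of c' a] inj[of c' b] h(2) hb d by auto
      then show False
      proof
        assume hc: "h c' = a"
        have "h d' \<in> {a, b, c', d'}" using into[of d'] set by auto
        then have "h d' = d'" using inj[of d' a] inj[of d' b] inj[of d' c'] h(2) hb hc d by auto
        then have "h = id" using no3[OF hH, of a b c'] out set sub by (metis insertE insert_subset singletonD)
        then show False using h(2) d by simp
      next
        assume hc: "h c' = d'"
        have "h d' \<in> {a, b, c', d'}" using into[of d'] set by auto
        then have hd: "h d' = a" using inj[of d' a] inj[of d' b] inj[of d' c'] h(2) hb hc d by auto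
        let ?k = "transpose a b \<circ> transpose c' d' \<circ> h"
        have "transpose a b \<circ> transpose c' d' \<in> alternating S"
          by (rule transpose_comp_in_alternating) (use sub set d in auto)
        then have "?k \<in> alternating S" using hG perm_groupD(3)[OF G] by blast
        moreover have "?k z = z" if "z \<noteq> b" "z \<noteq> d'" for z
          using that h(2) hc out[of z] set d by (cases "z = a \<or> z = c'") (auto simp: transpose_def)
        ultimately have "?k = id" by (rule alternating_fixes_all_but_two)
        then have "?k b = b" by simp
        then show False using hb d by (auto simp: transpose_def split: if_splits)
      qed
    qed
    have "h b \<in> {a, b, c, d}" using into by blast
    then have hb: "h b = a" using nc[of c d] nc[of d c] dist inj[of b a] h(2) by auto
    let ?t = "transpose a b \<circ> transpose c d"
    have "?t \<in> alternating S" by (rule transpose_comp_in_alternating) (use sub dist in auto)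
    then have "?t \<circ> h \<in> alternating S" using hG perm_groupD(3)[OF G] by blast
    moreover have "(?t \<circ> h) z = z" if "z \<noteq> c" "z \<noteq> d" for z
      using that h(2) hb out[of z] dist by (cases "z = a \<or> z = b") (auto simp: transpose_def)
    ultimately have id: "?t \<circ> h = id" by (rule alternating_fixes_all_but_two)
    have "?t \<circ> ?t = id" using dist by (auto simp: fun_eq_iff transpose_def)
    then have "h = ?t" using id by (metis comp_assoc comp_id id_comp)
    then show ?thesis using hH by simp
  qed
  have meet3: False if "F {a, b, c, d}" "F {a, b, c, e}" "distinct [a, b, c, d, e]" for a b c d e
  proof -
    \<comment> \<open>The product of the two double transpositions reduces to the 3-cycle
      \<open>transpose c d \<circ> transpose c e\<close>.\<close>
    let ?k = "(transpose a b \<circ> transpose c d) \<circ> (transpose a b \<circ> transpose c e)"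
    have "?k \<in> H" 
      by (rule perm_groupD(3)[OF H(1) dt[OF that(1)] dt[OF that(2)]]) (use that(3) in auto)
    moreover have "{c, d, e} \<subseteq> S" using that by (auto simp: F_def)
    moreover have "?k z = z" if "z \<noteq> c" "z \<noteq> d" "z \<noteq> e" for z using that \<open>distinct [a, b, c, d, e]\<close>
      by (auto simp: transpose_def)
    ultimately have "?k = id" by (rule no3)
    then have "?k e = e" by simp
    then show False using that(3) by (auto simp: transpose_def)
  qed
  have meet1: False if "F {a, b, c, d}" "F {a, e, f, g}" "distinct [a, b, c, d, e, f, g]" for a b c d e f g
  proof -
    let ?t = "transpose a b \<circ> transpose c d" and ?s = "transpose a e \<circ> transpose f g"
    \<comment> \<open>Since \<open>?t\<close> and \<open>?s\<close> are involutions, this square is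
      their commutator; their supports share only \<open>a\<close>, so it is a 3-cycle on
      \<open>a\<close>, \<open>b\<close>, \<open>e\<close>.\<close>
    let ?k = "?t \<circ> ?s \<circ> (?t \<circ> ?s)"
    have "?t \<in> H" "?s \<in> H" using that(3) dt[OF that(1)] dt[OF that(2)] by auto
    then have ts: "?t \<circ> ?s \<in> H" by (rule perm_groupD(3)[OF H(1)])
    have "?k \<in> H" by (rule perm_groupD(3)[OF H(1) ts ts])
    moreover have "{a, b, e} \<subseteq> S" using that by (auto simp: F_def)
    moreover have "?k z = z" if "z \<noteq> a" "z \<noteq> b" "z \<noteq> e" for z using that \<open>distinct [a, b, c, d, e, f, g]\<close>
      by (auto simp: transpose_def)
    ultimately have "?k = id" by (rule no3)
    then have "?k a = a" by simp
    then show False using that(3) by (auto simp: transpose_def)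
  qed
  have tt: "\<exists>h\<in>H. h x = x' \<and> h y = y'" if "x \<in> S" "y \<in> S" "x' \<in> S" "y' \<in> S" "x \<noteq> y" "x' \<noteq> y'" for x y x' y'
    using tuple_transitive[where m="card S - 2" and xs="[x, y]" and ys="[x', y']", OF H(1) S J] that n by auto
  have FX: "F X" using X by (simp add: F_def)
  have fX: "finite X" using X(2) by (intro card_ge_0_finite) simp
  obtain x0 y1 y2 y3 where Xeq: "X = {x0, y1, y2, y3}" and ys: "distinct [x0, y1, y2, y3]"
    using X(2) by (auto simp: card_Suc_eq numeral_eq_Suc)
  have cS: "card (S - X) = card S - 4" using X fX by (simp add: card_Diff_subset)
  from n show False
  proof
    assume "card S = 6"
    then have "card (S - X) = 2" using cS by simp
    then obtain u v where uv: "S - X = {u, v}" "u \<noteq> v" by (auto simp: card_2_iff)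
    then have inS: "u \<in> S" "v \<in> S" "y3 \<in> S" "u \<noteq> y3" "v \<notin> X" "u \<notin> X" using X(1) Xeq by auto
    \<comment> \<open>With six points, \<open>X\<close> is the complement of \<open>{u, v}\<close>;
      moving that pair to \<open>{u, y3}\<close> gives a Jordan set meeting \<open>X\<close> in
      three points.\<close>
    then obtain h where h: "h \<in> H" "h u = u" "h v = y3" using tt[of u v u y3] uv(2) by blast
    have p: "h permutes S" by (rule perm_groupD(1)[OF H(1) h(1)])
    have Seq: "S = X \<union> {u, v}" using uv X(1) by blast
    have "h ` X = h ` (S - {u, v})" using uv X(1) by (intro arg_cong[where f="image h"]) blast
    also have "\<dots> = S - {u, y3}"
      using image_set_diff[OF permutes_inj[OF p], of S "{u, v}"] permutes_image[OF p] h by simp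
    also have "\<dots> = {x0, y1, y2, v}" using Seq Xeq ys inS uv(2) by auto
    finally have "F {x0, y1, y2, v}" using Fim[OF FX h(1)] by simp
    then show False using meet3[of x0 y1 y2 y3 v] FX Xeq ys inS by auto
  next
    assume n9: "9 \<le> card S"
    have oS: "x0 \<in> S" "y1 \<in> S" "y2 \<in> S" "y3 \<in> S" using X(1) Xeq by auto
    \<comment> \<open>Overlaps of one and three points are excluded above, and \<open>x0\<close> is
      common, so a second set through \<open>x0\<close> shares exactly one more point with
      \<open>X\<close>.\<close>
    have split: "\<exists>y w z. y \<in> {y1, y2, y3} \<and> w \<notin> X \<and> z \<notin> X \<and> w \<noteq> z \<and> Y = {x0, y, w, z}"
      if Y: "F Y" "x0 \<in> Y" "Y \<noteq> X" for Y
    proof -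
      have fY: "finite Y" "card Y = 4" using Y(1) by (auto simp: F_def intro: card_ge_0_finite)
      have fI: "finite (X \<inter> Y)" using fX by simp
      have "card (X \<inter> Y) \<noteq> 0" using Y(2) Xeq fI by auto
      moreover have "card (X \<inter> Y) \<noteq> 4"
      proof
        assume "card (X \<inter> Y) = 4"
        then have "X \<inter> Y = X" "X \<inter> Y = Y" 
          using card_subset_eq[OF fX, of "X \<inter> Y"] card_subset_eq[OF fY(1), of "X \<inter> Y"] fY(2) X(2) by auto
        then show False using Y(3) by simp
      qed
      moreover have "card (X \<inter> Y) \<noteq> 1"
      proof
        assume c: "card (X \<inter> Y) = 1"
        then have e: "X \<inter> Y = {x0}" using Y(2) Xeq by (auto simp: card_1_singleton_iff)
        have "card (Y - {x0}) = 3" using fY Y(2) by simp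
        then obtain e f g where efg: "Y - {x0} = {e, f, g}" "distinct [e, f, g]" by (auto simp: card_3_iff)
        then have "Y = {x0, e, f, g}" using Y(2) by blast
        moreover have "e \<notin> X" "f \<notin> X" "g \<notin> X" using e efg(1) by blast+
        ultimately show False using meet1[of x0 y1 y2 y3 e f g] Y(1) FX Xeq ys efg(2) by auto
      qed
      moreover have "card (X \<inter> Y) \<noteq> 3"
      proof
        assume c: "card (X \<inter> Y) = 3"
        then obtain a b c where abc: "X \<inter> Y = {a, b, c}" "distinct [a, b, c]" by (auto simp: card_3_iff)
        have "card (X - Y) = 1" "card (Y - X) = 1"
          using card_Int_Diff[OF fX, of Y] card_Int_Diff[OF fY(1), of X] c X(2) fY(2) by (auto simp: Int_commute)
        then obtain d e where de: "X - Y = {d}" "Y - X = {e}" by (auto simp: card_1_singleton_iff)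
        have "X = {a, b, c, d}" "Y = {a, b, c, e}" using abc(1) de by blast+
        moreover have "d \<notin> {a, b, c}" "e \<notin> {a, b, c, d}" using abc(1) de by blast+
        ultimately show False using meet3[of a b c d e] Y(1) FX abc(2) by auto
      qed
      moreover have "card (X \<inter> Y) \<le> 4" using card_mono[of X "X \<inter> Y"] fX X(2) by simp
      ultimately have c2: "card (X \<inter> Y) = 2" by linarith
      then have "card (X \<inter> Y - {x0}) = 1" using Y(2) Xeq fI by (subst card_Diff_singleton) auto
      then obtain y where y: "X \<inter> Y - {x0} = {y}" by (auto simp: card_1_singleton_iff)
      have "card (Y - X) = 2" using card_Int_Diff[OF fY(1), of X] c2 fY(2) by (simp add: Int_commute)
      then obtain w z where wz: "Y - X = {w, z}" "w \<noteq> z" by (auto simp: card_2_iff)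
      have "x0 \<in> X" using Xeq by simp
      then have "Y = {x0, y, w, z}" using y wz(1) Y(2) by blast
      moreover have "y \<in> {y1, y2, y3}" using y Xeq by blast
      moreover have "w \<notin> X" "z \<notin> X" using wz by blast+
      ultimately show ?thesis using wz(2) by blast
    qed
    define R where "R y w z \<longleftrightarrow> y \<in> {y1, y2, y3} \<and> w \<notin> X \<and> z \<notin> X \<and> w \<noteq> z \<and> F {x0, y, w, z}" for y w z
    have splitR: "\<exists>y w z. R y w z \<and> Y = {x0, y, w, z}" if "F Y" "x0 \<in> Y" "Y \<noteq> X" for Y
      using split[OF that] that(1) unfolding R_def by blast
    have sym: "R y z w" if "R y w z" for y w z
    proof -
      have "{x0, y, w, z} = {x0, y, z, w}" by blast
      then show ?thesis using that by (auto simp: R_def)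
    qed
    have oX: "x0 \<in> X" using Xeq by simp
    have cover: "\<exists>y z. R y w z" if w: "w \<in> S - X" for w
    proof -
      have ow: "x0 \<noteq> w" "x0 \<noteq> y1" using w oX ys by auto
      obtain h where h: "h \<in> H" "h x0 = x0" "h y1 = w" using tt[of x0 y1 x0 w] oS w ow by blast
      have "x0 \<in> h ` X" "w \<in> h ` X" using h Xeq by (metis image_eqI insertI1 insertI2)+
      moreover have "h ` X \<noteq> X" using calculation w by blast
      ultimately obtain y u v where r: "R y u v" "h ` X = {x0, y, u, v}" using splitR[OF Fim[OF FX h(1)]] by blast
      have "w \<noteq> y" using r(1) w Xeq by (auto simp: R_def)
      then have "w = u \<or> w = v" using \<open>w \<in> h ` X\<close> r(2) ow by auto
      then show ?thesis using r(1) sym by blast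
    qed
    have ex: "\<exists>w z. R y w z" if y: "y \<in> {y1, y2, y3}" for y
    proof -
      have "card (S - X) > 0" using cS n9 by simp
      then obtain w0 where "w0 \<in> S - X" by (metis card.empty equals0I less_irrefl)
      then obtain y0 z0 where r0: "R y0 w0 z0" using cover by blast
      let ?Z = "{x0, y0, w0, z0}"
      have y0: "y0 \<in> S" "y \<in> S" "x0 \<noteq> y0" "x0 \<noteq> y" using r0 y oS ys by (auto simp: R_def)
      obtain h where h: "h \<in> H" "h x0 = x0" "h y0 = y" using tt[of x0 y0 x0 y] oS y0 by blast
      have ZX: "?Z \<noteq> X" "F ?Z" using r0 by (auto simp: R_def)
      have "y0 \<in> X" using r0 Xeq by (auto simp: R_def)
      then have mem: "x0 \<in> h ` X" "y \<in> h ` X" "x0 \<in> h ` ?Z" "y \<in> h ` ?Z" using h oX by (metis image_eqI insertI1 insertI2)+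
      \<comment> \<open>\<open>X\<close> and \<open>?Z\<close> both contain \<open>x0\<close> and
        \<open>y0\<close>, so their images contain \<open>x0\<close> and \<open>y\<close>; the
        images differ, so at least one is not \<open>X\<close>.\<close>
      have "h ` X \<noteq> h ` ?Z"
        using ZX(1) inj_image_eq_iff[OF permutes_inj[OF perm_groupD(1)[OF H(1) h(1)]]] by metis
      then obtain Y where Y: "F Y" "x0 \<in> Y" "y \<in> Y" "Y \<noteq> X" using mem Fim[OF FX h(1)] Fim[OF ZX(2) h(1)] by metis
      obtain y' w z where r: "R y' w z" "Y = {x0, y', w, z}" using splitR[OF Y(1,2,4)] by blast
      have "y \<in> X" using y Xeq by blast
      then have "y = y'" using Y(3) r y0 by (auto simp: R_def)
      then show ?thesis using r(1) by blast
    qed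
    have R_D: "y \<in> {y1, y2, y3}" "w \<noteq> z" "F {x0, y, w, z}" "w \<noteq> x0" "z \<noteq> x0" "y \<noteq> x0"
      "w \<notin> {y1, y2, y3}" "z \<notin> {y1, y2, y3}" if "R y w z" for y w z
      using that Xeq ys by (auto simp: R_def)
    have even1: False if "R y w z" "R y w z'" "z \<noteq> z'" for y w z z'
      using meet3[of x0 y w z z'] R_D[OF that(1)] R_D[OF that(2)] that(3) by auto
    have even2: False if "R y w z" "R y' w z" "y \<noteq> y'" for y y' w z
    proof -
      have "{x0, y, w, z} = {x0, w, z, y}" "{x0, y', w, z} = {x0, w, z, y'}" by blast+
      then show False using meet3[of x0 w z y y'] R_D[OF that(1)] R_D[OF that(2)] that(3) by auto
    qed
    have even3: "w \<in> {w', z'} \<or> z \<in> {w', z'}" if "R y w z" "R y' w' z'" "y \<noteq> y'" for y y' w z w' z'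
      using meet1[of x0 y w z y' w' z'] R_D[OF that(1)] R_D[OF that(2)] that(3) by auto
    show False
    proof (rule no_even_pair_system[of y1 y2 y3 "S - X" R])
      show "y1 \<noteq> y2" "y1 \<noteq> y3" "y2 \<noteq> y3" using ys by auto
      show "5 \<le> card (S - X)" using cS n9 by simp
      show "w \<in> {w', z'} \<longleftrightarrow> z \<in> {w', z'}" if "R y w z" "R y w' z'" for y w z w' z'
        using even1 that sym by (metis insertE insertI1 insertI2 singletonD)
      show "w \<in> {w', z'} \<longleftrightarrow> z \<notin> {w', z'}" if "y \<noteq> y'" "R y w z" "R y' w' z'" for y y' w z w' z'
        using even3[OF that(2,3,1)] even2[OF _ _ that(1)] that(2,3) sym R_D(2)[OF that(2)]
        by (metis insertE singletonD)
    qed (use sym R_D cover ex in auto)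
  qed
qed

section \<open>Subgroups of index prime to both primes\<close>

text \<open>\<open>H\<close> lies in the stabilizer of the orbit \<open>B\<close> of
  \<open>x\<close>, so \<open>card S choose card B\<close> divides the index of \<open>H\<close>; by
  \<open>bin\<close> this rules out a proper orbit.\<close>

lemma transitive_of_binomials:
  assumes S: "finite S" "3 \<le> card S" and H: "perm_group S H" "H \<subseteq> alternating S"
    and bin: "\<And>k. 0 < k \<Longrightarrow> k < card S \<Longrightarrow> p dvd (card S choose k) \<or> r dvd (card S choose k)"
    and idx: "\<not> p dvd card (alternating S) div card H" "\<not> r dvd card (alternating S) div card H"
  shows "jordan_set H S"
  unfolding jordan_set_def supported_self[OF H(1)]
proof (intro ballI)
  fix x y assume xy: "x \<in> S" "y \<in> S"
  define B where "B = (\<lambda>h. h x) ` H"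
  have G: "perm_group S (alternating S)" by (rule perm_group_alternating[OF S(1)])
  have BS: "B \<subseteq> S" using permutes_in_image[OF perm_groupD(1)[OF H(1)]] xy(1) by (auto simp: B_def)
  have xB: "x \<in> B" unfolding B_def using perm_groupD(2)[OF H(1)] by (metis id_apply image_eqI)
  have hB: "h ` B \<subseteq> B" if "h \<in> H" for h
  proof
    fix z assume "z \<in> h ` B"
    then obtain g where "g \<in> H" "z = (h \<circ> g) x" by (auto simp: B_def)
    then show "z \<in> B" using perm_groupD(3)[OF H(1) that] unfolding B_def by blast
  qed
  have fB: "finite B" using BS S(1) finite_subset by blast
  let ?W = "{h\<in>alternating S. h ` B = B}"
  have W: "perm_group S ?W" by (rule perm_group_stabilizer[OF G]) (auto simp: image_comp)
  have "H \<subseteq> ?W"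
  proof
    fix h assume h: "h \<in> H"
    have "h ` B = B" using hB[OF h] card_image[OF permutes_inj_on[OF perm_groupD(1)[OF H(1) h]], of B] fB
      by (intro card_subset_eq) auto
    then show "h \<in> ?W" using h H(2) by auto
  qed
  then obtain c where c: "card ?W = card H * c" using perm_group_lagrange[OF W H(1) _ S(1)] unfolding dvd_def by blast
  have "card (alternating S) = card H * ((card S choose card B) * c)"
    using card_set_stabilizer_alternating[OF S BS] c by (simp add: mult_ac)
  then have i: "card (alternating S) div card H = (card S choose card B) * c"
    using card_perm_group_pos[OF H(1) S(1)] by simp
  have "B = S"
  proof (rule ccontr)
    assume "B \<noteq> S"
    then have "card B < card S" using BS S(1) by (simp add: psubset_card_mono psubsetI)
    moreover have "0 < card B" using xB fB by (auto simp: card_gt_0_iff)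
    ultimately show False using bin[of "card B"] idx unfolding i by auto
  qed
  then show "\<exists>h\<in>H. h x = y" using xy(2) by (auto simp: B_def)
qed

lemma alternating_of_odd_prime:
  assumes S: "finite S" "6 \<le> card S" and H: "perm_group S H" "H \<subseteq> alternating S" and prim: "primitive_on H S"
    and npp: "\<not> primepow (card S)"
    and q: "prime q" "odd q" "q \<le> card S" "\<not> q dvd card (alternating S) div card H"
    and s: "prime s" "s \<noteq> q" "s \<le> card S" "\<not> s dvd card (alternating S) div card H"
  shows "alternating S \<subseteq> H"
proof -
  have not_card: "t \<noteq> card S" if "prime t" for t using that npp by auto
  have large: "alternating S \<subseteq> H"
    if t: "prime t" "odd t" "t \<le> card S" "\<not> t dvd card (alternating S) div card H" "t + 3 \<le> card S" for t
  proof -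
    obtain X x c where "X \<subseteq> S" "full_cycle t X x c" "c \<in> H" using cycle_of_prime_index[OF S(1) H t(1-4)] by blast
    then show ?thesis using jordan_prime_cycle[OF S(1) H prim _ _ _ t(1,5)] by blast
  qed
  consider "q + 3 \<le> card S" | "odd s" "s + 3 \<le> card S" | "s = 2"
  proof (cases "odd s")
    case True
    have "q \<noteq> card S" "s \<noteq> card S" using not_card q(1) s(1) by auto
    then have "q + 3 \<le> card S \<or> s + 3 \<le> card S" using True q(2,3) s(2,3) by presburger
    then show ?thesis using that True by blast
  next
    case False
    then have "s = 2" using s(1) primes_dvd_imp_eq two_is_prime_nat by blast
    then show ?thesis using that by blast
  qed
  then show ?thesis
  proof cases
    case 1 then show ?thesis using large q by blast
  next
    case 2 then show ?thesis using large s by blast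
  next
    case 3
    obtain X where X: "X \<subseteq> S" "card X = 4" "jordan_set H X"
      using jordan_set_of_prime_power_card[OF S(1) H s(1,4), of 2] 3 S(2) by auto
    have "3 \<le> q" using q(1,2) prime_ge_2_nat[OF q(1)] by (cases "q = 2") auto
    then obtain Y where Y: "Y \<subseteq> S" "card Y = q" "jordan_set H Y"
      using jordan_set_of_prime_power_card[OF S(1) H q(1,4), of 1] q(3) by auto
    have pY: "primitive_on H Y" using primitive_on_of_prime_card[OF H(1) Y(3)] Y(2) q(1) by simp
    have "q < card S" using not_card[OF q(1)] q(3) by simp
    then have J: "jordan_set H Z" if "Z \<subseteq> S" "card S - 2 < card Z" for Z
      using all_large_sets_jordan[OF H(1) S(1) prim pY Y(1) _ that(1)] that(2) Y(2) \<open>3 \<le> q\<close> by linarith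
    have "prime (7 :: nat)" by simp
    then have "card S \<noteq> 7" using not_card[of 7] by metis
    moreover have "card S \<noteq> 8"
    proof
      assume "card S = 8"
      then have "card S = 2 ^ 3" by simp
      then show False using npp by (metis primepow_def two_is_prime_nat zero_less_numeral)
    qed
    ultimately have "card S = 6 \<or> 9 \<le> card S" using S(2) by linarith
    then show ?thesis using jordan_four_sets[OF S(1) H prim J X] by blast
  qed
qed

lemma alternating_of_binomials:
  assumes S: "finite S" "1 < card S" and H: "perm_group S H" "H \<subseteq> alternating S"
    and pr: "prime p" "prime r" and npp: "\<not> primepow (card S)"
    and bin: "\<And>k. 0 < k \<Longrightarrow> k < card S \<Longrightarrow> p dvd (card S choose k) \<or> r dvd (card S choose k)"
    and idx: "\<not> p dvd card (alternating S) div card H" "\<not> r dvd card (alternating S) div card H"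
  shows "alternating S \<subseteq> H"
proof -
  have missing: "\<exists>k. 0 < k \<and> k < card S \<and> \<not> q dvd (card S choose k)" if q: "prime q" for q
  proof (rule ccontr)
    assume "\<not> ?thesis"
    then obtain t where t: "card S = q ^ t" using prime_power_if_dvd_binomials[OF q, of "card S"] S(2) by auto
    then have "0 < t" using S(2) by (cases t) auto
    then show False using npp q t unfolding primepow_def by blast
  qed
  have le: "q \<le> card S" if q: "prime q" "prime s"
    "\<And>k. 0 < k \<Longrightarrow> k < card S \<Longrightarrow> q dvd (card S choose k) \<or> s dvd (card S choose k)" for q s
  proof (rule ccontr)
    assume nl: "\<not> q \<le> card S"
    obtain k where k: "0 < k" "k < card S" "\<not> s dvd (card S choose k)" using missing[OF q(2)] by blast
    have "(card S choose k) dvd fact (card S)" using binomial_fact_lemma[of k "card S"] k(2) by (metis dvd_triv_right less_imp_le)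
    then have "q dvd fact (card S)" using q(3)[OF k(1,2)] k(3) dvd_trans by blast
    then show False using nl q(1) by (simp add: prime_dvd_fact_iff)
  qed
  have ppr: "p \<noteq> r" using missing[OF pr(1)] bin by blast
  have pl: "p \<le> card S" using le[OF pr bin] .
  have rl: "r \<le> card S" using le[OF pr(2,1)] bin by blast
  have S6: "6 \<le> card S"
  proof (rule ccontr)
    assume "\<not> 6 \<le> card S"
    then have "card S = 2 \<or> card S = 3 \<or> card S = 2 ^ 2 \<or> card S = 5" using S(2) by (simp; linarith)
    moreover have "prime (2 :: nat)" "prime (3 :: nat)" "prime (5 :: nat)" by simp_all
    ultimately have "primepow (card S)"
      by (metis primepow_def primepow_prime zero_less_numeral)
    then show False using npp by simp
  qed
  have S3: "3 \<le> card S" using S6 by simp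
  have "jordan_set H S" using transitive_of_binomials[OF S(1) S3 H bin idx] .
  then have prim: "primitive_on H S" using primitive_of_binomials[OF S(1) S3 H _ pr ppr npp bin idx] by blast
  have "odd p \<or> odd r" using pr ppr by (metis primes_dvd_imp_eq two_is_prime_nat)
  then show ?thesis
    using alternating_of_odd_prime[OF S(1) S6 H prim npp pr(1) _ pl idx(1) pr(2) ppr[symmetric] rl idx(2)]
      alternating_of_odd_prime[OF S(1) S6 H prim npp pr(2) _ rl idx(2) pr(1) ppr pl idx(1)] by blast
qed

lemma carrier_alt_group: "carrier (alt_group n) = alternating {1..n}"
  by (auto simp: alternating_def alt_group_carrier)

lemma subgroup_alt_group_iff: "subgroup H (alt_group n) \<longleftrightarrow> perm_group {1..n} H \<and> H \<subseteq> alternating {1..n}"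
proof
  assume H: "subgroup H (alt_group n)"
  have sub: "H \<subseteq> carrier (alt_group n)" using subgroup.subset[OF H] .
  have "inv' h \<in> H" if "h \<in> H" for h
    using subgroup.m_inv_closed[OF H that] alt_group_inv_equality[of h n] sub that by auto
  then show "perm_group {1..n} H \<and> H \<subseteq> alternating {1..n}"
    using sub subgroup.one_closed[OF H] subgroup.m_closed[OF H]
    unfolding perm_group_def carrier_alt_group[symmetric]
    by (auto simp: alt_group_mult alt_group_one alt_group_carrier)
next
  assume H: "perm_group {1..n} H \<and> H \<subseteq> alternating {1..n}"
  then have sub: "H \<subseteq> carrier (alt_group n)" by (simp add: carrier_alt_group)
  show "subgroup H (alt_group n)"
  proof (rule group.subgroupI[OF alt_group_is_group sub])
    show "H \<noteq> {}" using H perm_groupD(2) by blast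
    show "inv\<^bsub>alt_group n\<^esub> h \<in> H" if "h \<in> H" for h
      using that H perm_groupD(4)[of "{1..n}" H h] alt_group_inv_equality[of h n] sub by auto
    show "g \<otimes>\<^bsub>alt_group n\<^esub> h \<in> H" if "g \<in> H" "h \<in> H" for g h
      using that H perm_groupD(3)[of "{1..n}" H g h] by (simp add: alt_group_mult)
  qed
qed

lemma card_rcosets_alt_group:
  assumes "subgroup H (alt_group n)"
  shows "card (rcosets\<^bsub>alt_group n\<^esub> H) = card (alternating {1..n}) div card H"
proof -
  have "card (rcosets\<^bsub>alt_group n\<^esub> H) * card H = card (alternating {1..n})"
    using group.lagrange[OF alt_group_is_group assms] by (simp add: order_def carrier_alt_group)
  moreover have "0 < card H" using assms card_perm_group_pos subgroup_alt_group_iff by blast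
  ultimately show ?thesis by (metis nonzero_mult_div_cancel_right less_irrefl)
qed

theorem theorem1p3:
  fixes p r n :: nat
  assumes "prime p" and "prime r" and "n > 0" and "\<not> primepow n"
  shows "(\<forall>k. 1 \<le> k \<and> k \<le> n - 1 \<longrightarrow> p dvd (n choose k) \<or> r dvd (n choose k)) \<longleftrightarrow>
    (\<forall>H. subgroup H (alt_group n) \<and> H \<noteq> carrier (alt_group n) \<longrightarrow>
       p dvd card (rcosets\<^bsub>alt_group n\<^esub> H) \<or> r dvd card (rcosets\<^bsub>alt_group n\<^esub> H))"
  (is "?bin \<longleftrightarrow> ?idx")
proof
  assume bin: ?bin
  show ?idx
  proof (intro allI impI, rule ccontr)
    fix H assume H: "subgroup H (alt_group n) \<and> H \<noteq> carrier (alt_group n)"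
      and no: "\<not> (p dvd card (rcosets\<^bsub>alt_group n\<^esub> H) \<or> r dvd card (rcosets\<^bsub>alt_group n\<^esub> H))"
    have grp: "perm_group {1..n} H" "H \<subseteq> alternating {1..n}" using H subgroup_alt_group_iff by blast+
    have "alternating {1..n} \<subseteq> H"
    proof (cases "n = 1")
      case True
      then show ?thesis using perm_groupD(2)[OF grp(1)] by (auto simp: alternating_def)
    next
      case False
      show ?thesis
      proof (rule alternating_of_binomials[OF _ _ grp assms(1,2)])
        show "\<not> p dvd card (alternating {1..n}) div card H" "\<not> r dvd card (alternating {1..n}) div card H"
          using no card_rcosets_alt_group H by auto
      qed (use False assms bin in auto)
    qed
    then show False using H grp(2) by (auto simp: carrier_alt_group)
  qed
next
  assume idx: ?idx
  show ?bin
  proof (intro allI impI)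
    fix k assume k: "1 \<le> k \<and> k \<le> n - 1"
    have n3: "3 \<le> n"
    proof -
      have "n \<noteq> 2" using assms(4) primepow_prime two_is_prime_nat by metis
      then show ?thesis using k by linarith
    qed
    let ?W = "{h\<in>alternating {1..n}. h ` {1..k} = {1..k}}"
    have W: "perm_group {1..n} ?W" by (rule perm_group_stabilizer[OF perm_group_alternating]) (auto simp: image_comp)
    then have sub: "subgroup ?W (alt_group n)" unfolding subgroup_alt_group_iff by blast
    have "(card {1..n} choose card {1..k}) * card ?W = card (alternating {1..n})"
      by (rule card_set_stabilizer_alternating) (use n3 k in auto)
    then have eq: "(n choose k) * card ?W = card (alternating {1..n})" by simp
    have pos: "0 < card ?W" by (rule card_perm_group_pos[OF W]) simp
    have i: "card (rcosets\<^bsub>alt_group n\<^esub> ?W) = n choose k"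
      unfolding card_rcosets_alt_group[OF sub] using eq[symmetric] pos by simp
    have "?W \<noteq> carrier (alt_group n)"
    proof
      assume "?W = carrier (alt_group n)"
      moreover obtain h where "h \<in> alternating {1..n}" "h 1 = n"
        using alternating_transitive[of "{1..n}" 1 n] n3 by auto
      ultimately have "h ` {1..k} = {1..k}" by (auto simp: carrier_alt_group)
      then have "h 1 \<in> {1..k}" using k by (metis atLeastAtMost_iff image_eqI order_refl)
      then show False using \<open>h 1 = n\<close> k n3 by auto
    qed
    then show "p dvd (n choose k) \<or> r dvd (n choose k)" using idx sub i by metis
  qed
qed

end
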